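(* Let $X$ be a random vector in $\mathbb{R}^q$ and $Y$ a categorical random variable with values in $\mathbb{Y}=\{L_1,\dots,L_K\}$, $\Pr(Y=L_k)=p_k\in(0,1)$ for each $k$. Let $(x_1,y_1),\dots,(x_n,y_n)$ be an iid sample of $(X,Y)$ and let $\kappa$ be a Mercer kernel on $\mathbb{R}^q$ whose induced distance function $d_\kappa$ takes values in $[0,1)$. Let $G$ be the event that $n_k>2$ for all $k$. Then for any $c>0$ and $t\in(0,\tfrac12)$: (Type I) if $\mathrm{gCov}_\kappa(X,Y)=0$, then $$\Pr\left[G\ \text{and}\ \mathrm{gCov}_\kappa^n\ge cn^{-t}\right]\le\exp\left(-\frac{c^2n^{1-2t}}{12.5}\right);$$ (Type II) if $\mathrm{gCov}_\kappa(X,Y)\ge2cn^{-t}$, then $$\Pr\left[G\ \text{and}\ \mathrm{gCov}_\kappa^n\le cn^{-t}\right]\le\exp\left(-\frac{c^2n^{1-2t}}{12.5}\right).$$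
   Context: A Mercer kernel on $\mathbb{R}^q$ is a continuous, symmetric, positive (semi)definite function $\kappa:\mathbb{R}^q\times\mathbb{R}^q\to\mathbb{R}$; it induces $d_\kappa(x,x')=\sqrt{\kappa(x,x)+\kappa(x',x')-2\kappa(x,x')}$. Let $F$ be the distribution of $X$ and $F_k$ the conditional distribution of $X$ given $Y=L_k$, so $F=\sum_kp_kF_k$. Let $X,X'\sim F$ and $X_k,X_k'\sim F_k$, all independent. Put $\Delta=\mathbb{E}d_\kappa(X,X')$, $\Delta_k=\mathbb{E}d_\kappa(X_k,X_k')$. The generalized Gini distance covariance is $$\mathrm{gCov}_\kappa(X,Y)=\sum_{k=1}^K p_k\left[2\,\mathbb{E}d_\kappa(X_k,X)-\mathbb{E}d_\kappa(X_k,X_k')-\mathbb{E}d_\kappa(X,X')\right]=\Delta-\sum_{k=1}^Kp_k\Delta_k.$$ Given the sample, let $\mathcal{I}_k=\{i: y_i=L_k\}$, $n_k=|\mathcal{I}_k|$, $\hat p_k=n_k/n$, and $$\hat\Delta_k=\binom{n_k}{2}^{-1}\sum_{i<j\in\mathcal{I}_k}d_\kappa(x_i,x_j),\qquad \hat\Delta=\binom n2^{-1}\sum_{i<j}d_\kappa(x_i,x_j),\qquad \mathrm{gCov}_\kappa^n=\hat\Delta-\sum_{k=1}^K\hat p_k\hat\Delta_k .$$ The estimator is considered only for samples with $n_k>2$ for all $k$. The null hypothesis $H_0$ is $\mathrm{gCov}_\kappa(X,Y)=0$, the alternative $H_1$ is $\mathrm{gCov}_\kappa(X,Y)\ge2cn^{-t}$,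 and $H_0$ is rejected when $\mathrm{gCov}^n_\kappa\ge cn^{-t}$. *)

theory Defs
  imports "HOL-Probability.Probability"
begin

definition pos_semidef_kernel :: "('a \<Rightarrow> 'a \<Rightarrow> real) \<Rightarrow> bool" where
  "pos_semidef_kernel \<kappa> \<longleftrightarrow>
    (\<forall>(m::nat) (a :: nat \<Rightarrow> real) (z :: nat \<Rightarrow> 'a).
       0 \<le> (\<Sum>i<m. \<Sum>j<m. a i * a j * \<kappa> (z i) (z j)))"

definition mercer_kernel :: "('a::topological_space \<Rightarrow> 'a \<Rightarrow> real) \<Rightarrow> bool" where
  "mercer_kernel \<kappa> \<longleftrightarrow>
    continuous_on UNIV (\<lambda>(x, x'). \<kappa> x x') \<and>
    (\<forall>x x'. \<kappa> x x' = \<kappa> x' x) \<and>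
    pos_semidef_kernel \<kappa>"

definition kernel_dist :: "('a \<Rightarrow> 'a \<Rightarrow> real) \<Rightarrow> 'a \<Rightarrow> 'a \<Rightarrow> real" where
  "kernel_dist \<kappa> x x' = sqrt (\<kappa> x x + \<kappa> x' x' - 2 * \<kappa> x x')"

text \<open>Expected distance of two independent points with laws \<open>P\<close> and \<open>Q\<close>;
  independence is expressed by the product measure.\<close>

definition mean_dist :: "('a \<Rightarrow> 'a \<Rightarrow> real) \<Rightarrow> 'a measure \<Rightarrow> 'a measure \<Rightarrow> real" where
  "mean_dist \<kappa> P Q = (\<integral>(x, x'). kernel_dist \<kappa> x x' \<partial>(P \<Otimes>\<^sub>M Q))"

definition cond_law ::
  "'w measure \<Rightarrow> ('w \<Rightarrow> 'a::topological_space) \<Rightarrow> ('w \<Rightarrow> 'l) \<Rightarrow> 'l \<Rightarrow> 'a measure" where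
  "cond_law M X Y l = distr (uniform_measure M {\<omega> \<in> space M. Y \<omega> = l}) borel X"

definition gini_cov ::
  "('a::topological_space \<Rightarrow> 'a \<Rightarrow> real) \<Rightarrow> 'w measure \<Rightarrow> ('w \<Rightarrow> 'a) \<Rightarrow> ('w \<Rightarrow> 'l) \<Rightarrow>
   (nat \<Rightarrow> 'l) \<Rightarrow> nat \<Rightarrow> real" where
  "gini_cov \<kappa> M X Y L K =
    (let F = distr M borel X; Fk = (\<lambda>k. cond_law M X Y (L k)) in
     \<Sum>k=1..K. \<P>(\<omega> in M. Y \<omega> = L k) *
       (2 * mean_dist \<kappa> (Fk k) F - mean_dist \<kappa> (Fk k) (Fk k) - mean_dist \<kappa> F F))"

text \<open>A sample of size \<open>n\<close> is a pair of sequences \<open>x\<close>, \<open>y\<close>, of which only the entries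
  with index in \<open>{1..n}\<close> matter.\<close>

definition class_idx :: "nat \<Rightarrow> (nat \<Rightarrow> 'l) \<Rightarrow> 'l \<Rightarrow> nat set" where
  "class_idx n y l = {i \<in> {1..n}. y i = l}"

definition pair_avg :: "('a \<Rightarrow> 'a \<Rightarrow> real) \<Rightarrow> (nat \<Rightarrow> 'a) \<Rightarrow> nat set \<Rightarrow> real" where
  "pair_avg \<kappa> x I =
    (\<Sum>(i, j) \<in> {(i, j). i \<in> I \<and> j \<in> I \<and> i < j}. kernel_dist \<kappa> (x i) (x j)) / real (card I choose 2)"

text \<open>Division by zero makes the summands of classes with fewer than two points vanish; the
  estimator is meant to be used only on samples where every class has more than two points.\<close>

definition gini_cov_est ::
  "('a \<Rightarrow> 'a \<Rightarrow> real) \<Rightarrow> nat \<Rightarrow> (nat \<Rightarrow> 'a) \<Rightarrow> (nat \<Rightarrow> 'l) \<Rightarrow> (nat \<Rightarrow> 'l) \<Rightarrow> nat \<Rightarrow> real" where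
  "gini_cov_est \<kappa> n x y L K =
    pair_avg \<kappa> x {1..n} -
    (\<Sum>k=1..K. real (card (class_idx n y (L k))) / real n * pair_avg \<kappa> x (class_idx n y (L k)))"

end

theory Submission
  imports Defs
begin

text \<open>The event \<open>G\<close> couples all sample points and the estimator is biased off \<open>G\<close>, so the bounded differences
  inequality does not apply to it directly. Instead we extend the estimator from \<open>G\<close> to all samples:
  where a class contains a single point, its undefined average distance is replaced by the true mean
  \<open>\<Delta>\<^sub>k\<close>. The extension is unbiased, because \<open>n\<^sub>k\<close> times the class average is
  \<open>n\<^sub>k \<Delta>\<^sub>k + 2 / (n\<^sub>k - 1) \<Sum> (d(x\<^sub>i, x\<^sub>j) - \<Delta>\<^sub>k)\<close>, and for a pair in class \<open>k\<close> the centred distance is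
  independent of the size of the class. Adding a point to a class changes \<open>n\<^sub>k\<close> times its average by
  an amount in \<open>[-1, 2]\<close>, so moving one sample point changes the class part by at most \<open>3 / n\<close> and the
  overall average by at most \<open>2 / n\<close>. McDiarmid's inequality with differences \<open>5 / n\<close> then gives
  \<open>exp (- 2 n \<epsilon>\<^sup>2 / 25)\<close>.\<close>

section \<open>McDiarmid's inequality\<close>

text \<open>The coordinates of \<open>x\<close> are exchanged for those of \<open>x0\<close> one at
  a time; \<open>A\<close> in the proof is the set of those already exchanged, and exchanging
  \<open>i\<close> costs at most \<open>c i\<close>.\<close>

lemma bounded_differences_imp_bounded:
  fixes f :: "('i \<Rightarrow> 'a) \<Rightarrow> real"
  assumes "finite J"
    and diff: "\<And>x i y. x \<in> PiE J S \<Longrightarrow> i \<in> J \<Longrightarrow> y \<in> S i \<Longrightarrow> \<bar>f x - f (x(i := y))\<bar> \<le> c i"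
    and x: "x \<in> PiE J S" and x0: "x0 \<in> PiE J S"
  shows "\<bar>f x - f x0\<bar> \<le> (\<Sum>i\<in>J. c i)"
proof -
  have "\<bar>f x - f (\<lambda>i. if i \<in> A then x0 i else x i)\<bar> \<le> (\<Sum>i\<in>A. c i)" if "A \<subseteq> J" for A
    using finite_subset[OF that \<open>finite J\<close>] that
  proof (induction A rule: finite_induct)
    case empty
    then show ?case by simp
  next
    case (insert a A)
    let ?z = "\<lambda>i. if i \<in> A then x0 i else x i"
    have "?z \<in> PiE J S"
      using x x0 insert.prems by (auto simp: PiE_iff extensional_def)
    moreover have "x0 a \<in> S a" using x0 insert.prems by auto
    ultimately have "\<bar>f ?z - f (?z(a := x0 a))\<bar> \<le> c a"
      using insert.prems by (intro diff) auto
    moreover have "?z(a := x0 a) = (\<lambda>i. if i \<in> insert a A then x0 i else x i)"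
      by auto
    ultimately show ?case
      using insert by fastforce
  qed
  from this[of J] have "\<bar>f x - f (\<lambda>i. if i \<in> J then x0 i else x i)\<bar> \<le> (\<Sum>i\<in>J. c i)"
    by simp
  moreover have "(\<lambda>i. if i \<in> J then x0 i else x i) = x0"
    using x x0 by (fastforce simp: PiE_iff extensional_def)
  ultimately show ?thesis by simp
qed

context product_prob_space
begin

lemma prob_space_PiM_subset: "prob_space (PiM J M)"
  by (intro prob_space_PiM M.prob_space_axioms)

text \<open>Bounded differences confine \<open>f\<close> to a bounded range around its value at any
  fixed point, so on a probability space measurability already gives integrability.\<close>

lemma bounded_differences_integrable:
  fixes f :: "('i \<Rightarrow> 'a) \<Rightarrow> real"
  assumes "finite J" and "f \<in> borel_measurable (PiM J M)"
    and diff: "\<And>x i y. x \<in> space (PiM J M) \<Longrightarrow> i \<in> J \<Longrightarrow> y \<in> space (M i) \<Longrightarrow>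
      \<bar>f x - f (x(i := y))\<bar> \<le> c i"
  shows "integrable (PiM J M) f"
proof -
  interpret PJ: prob_space "PiM J M" by (rule prob_space_PiM_subset)
  obtain x0 where x0: "x0 \<in> space (PiM J M)" using PJ.not_empty by blast
  have "\<bar>f x - f x0\<bar> \<le> (\<Sum>i\<in>J. c i)" if "x \<in> space (PiM J M)" for x
    using bounded_differences_imp_bounded[of J "\<lambda>i. space (M i)" f c x x0] assms x0 that
    by (auto simp: space_PiM)
  then have "AE x in PiM J M. norm (f x) \<le> \<bar>f x0\<bar> + (\<Sum>i\<in>J. c i)"
    by (intro AE_I2) (smt (verit) real_norm_def)
  then show ?thesis
    using assms(2) by (rule PJ.integrable_const_bound)
qed

text \<open>The induction integrates out one coordinate at a time, which plays the role of the
  martingale differences. With \<open>g\<close> the average of \<open>f\<close> over coordinate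
  \<open>i\<close>, the exponent splits into \<open>f - g\<close>, handled by Hoeffding's lemma for
  fixed remaining coordinates, and \<open>g - E\<close>, handled by the induction
  hypothesis.\<close>

lemma bounded_differences_exp_moment:
  fixes f :: "('i \<Rightarrow> 'a) \<Rightarrow> real"
  assumes "l > 0" and "finite J" and "f \<in> borel_measurable (PiM J M)"
    and "\<And>x i y. x \<in> space (PiM J M) \<Longrightarrow> i \<in> J \<Longrightarrow> y \<in> space (M i) \<Longrightarrow>
      \<bar>f x - f (x(i := y))\<bar> \<le> c i"
  shows "(\<integral>\<^sup>+x. exp (l * (f x - (\<integral>z. f z \<partial>PiM J M))) \<partial>PiM J M)
    \<le> ennreal (exp (l\<^sup>2 * (\<Sum>i\<in>J. (c i)\<^sup>2) / 8))"
  using assms(2-)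
proof (induction J arbitrary: f rule: finite_induct)
  case empty
  then show ?case
    by (simp add: PiM_empty nn_integral_count_space_finite lebesgue_integral_count_space_finite)
next
  case (insert i J)
  note [measurable] = insert.prems(1)
  interpret Q: prob_space "PiM J M" by (rule prob_space_PiM_subset)
  define g where "g x = (\<integral>y. f (x(i := y)) \<partial>M i)" for x
  define E where "E = (\<integral>z. f z \<partial>PiM (insert i J) M)"
  have upd: "x(i := y) \<in> space (PiM (insert i J) M)"
    if "x \<in> space (PiM J M)" "y \<in> space (M i)" for x y
    using that by (auto simp: space_PiM PiE_iff extensional_def)
  have f_upd [measurable]:
    "(\<lambda>p. f ((fst p)(i := snd p))) \<in> borel_measurable (PiM J M \<Otimes>\<^sub>M M i)"
    using measurable_compose[OF measurable_add_dim insert.prems(1)]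
    by (simp add: case_prod_unfold)
  have [measurable]: "(\<lambda>y. f (x(i := y))) \<in> borel_measurable (M i)"
    if "x \<in> space (PiM J M)" for x
    using measurable_compose[OF measurable_Pair1'[OF that] f_upd] by simp
  have g_meas [measurable]: "g \<in> borel_measurable (PiM J M)"
    unfolding g_def by measurable
  have E_eq: "E = (\<integral>x. g x \<partial>PiM J M)"
    unfolding E_def g_def
    by (intro product_integral_insert insert.hyps insert.prems finite.insertI
        bounded_differences_integrable[where c = c])
  have osc: "\<bar>f (x(i := y)) - f (x(i := y'))\<bar> \<le> c i"
    if "x \<in> space (PiM J M)" "y \<in> space (M i)" "y' \<in> space (M i)" for x y y'
    using insert.prems(2)[OF upd[OF that(1,2)] insertI1 that(3)] by (simp only: fun_upd_upd)
  \<comment> \<open>Any two values along coordinate \<open>i\<close> differ by at most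
    \<open>c i\<close>, so an interval of length \<open>c i\<close> starting at the infimum holds
    them all. Centring the interval at one value would double its length and spoil the
    constant.\<close>
  have bounded: "interval_bounded_random_variable (M i) (\<lambda>y. f (x(i := y)))
      (INF y\<in>space (M i). f (x(i := y))) ((INF y\<in>space (M i). f (x(i := y))) + c i)"
    (is "interval_bounded_random_variable _ _ ?a _")
    if x: "x \<in> space (PiM J M)" for x
  proof
    show "AE y in M i. f (x(i := y)) \<in> {?a..?a + c i}"
    proof (rule AE_I2)
      fix y assume y: "y \<in> space (M i)"
      have "bdd_below ((\<lambda>y. f (x(i := y))) ` space (M i))"
        by (rule bdd_belowI2[of _ "f (x(i := y)) - c i"]) (use osc[OF x y] in fastforce)
      then have "?a \<le> f (x(i := y))"
        using y by (rule cINF_lower)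
      moreover have "f (x(i := y)) - c i \<le> ?a"
        by (rule cINF_greatest) (use y osc[OF x y] in fastforce)+
      ultimately show "f (x(i := y)) \<in> {?a..?a + c i}" by simp
    qed
  qed (use x in measurable)
  have integrable_upd: "integrable (M i) (\<lambda>y. f (x(i := y)))" if "x \<in> space (PiM J M)" for x
    using interval_bounded_random_variable.integrable[OF bounded[OF that]] .
  \<comment> \<open>Averaging over coordinate \<open>i\<close> preserves the bounded differences in
    all other coordinates, so the induction hypothesis applies to \<open>g\<close>.\<close>
  have g_diff: "\<bar>g x - g (x(j := y))\<bar> \<le> c j"
    if x: "x \<in> space (PiM J M)" and j: "j \<in> J" and y: "y \<in> space (M j)" for x j y
  proof -
    have xj: "x(j := y) \<in> space (PiM J M)"
      using x j y by (auto simp: space_PiM PiE_iff extensional_def)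
    have "j \<noteq> i" using j insert.hyps by auto
    have *: "\<bar>f (x(i := z)) - f (x(j := y, i := z))\<bar> \<le> c j" if "z \<in> space (M i)" for z
      using insert.prems(2)[OF upd[OF x that] insertI2[OF j] y]
      by (simp only: fun_upd_twist[OF \<open>j \<noteq> i\<close>])
    have int: "integrable (M i) (\<lambda>z. f (x(i := z)) - f (x(j := y, i := z)))"
      by (intro Bochner_Integration.integrable_diff integrable_upd x xj)
    have "g x - g (x(j := y)) = (\<integral>z. f (x(i := z)) - f (x(j := y, i := z)) \<partial>M i)"
      unfolding g_def
      by (intro Bochner_Integration.integral_diff[symmetric] integrable_upd x xj)
    moreover have "\<dots> \<le> c j"
      by (rule M.integral_le_const[OF int]) (use * in \<open>auto intro!: AE_I2 dest: abs_le_D1\<close>)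
    moreover have "- c j \<le> (\<integral>z. f (x(i := z)) - f (x(j := y, i := z)) \<partial>M i)"
      by (rule M.integral_ge_const[OF int]) (use * in \<open>fastforce intro!: AE_I2\<close>)
    ultimately show ?thesis by simp
  qed
  have "(\<integral>\<^sup>+x. exp (l * (f x - E)) \<partial>PiM (insert i J) M)
      = (\<integral>\<^sup>+x. \<integral>\<^sup>+y. exp (l * (f (x(i := y)) - E)) \<partial>M i \<partial>PiM J M)"
    by (intro product_nn_integral_insert insert.hyps) measurable
  \<comment> \<open>The factor with \<open>g x - E\<close> does not depend on \<open>y\<close> and
    leaves the inner integral; what remains inside is centred, since \<open>g x\<close> is the mean
    over \<open>y\<close>.\<close>
  also have "\<dots> = (\<integral>\<^sup>+x. (\<integral>\<^sup>+y. exp (l * (f (x(i := y)) - g x)) \<partial>M i)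
      * ennreal (exp (l * (g x - E))) \<partial>PiM J M)"
    by (intro nn_integral_cong, subst nn_integral_multc[symmetric])
       (auto simp: ennreal_mult[symmetric] exp_add[symmetric] algebra_simps)
  also have "\<dots> \<le> (\<integral>\<^sup>+x. ennreal (exp (l\<^sup>2 * (c i)\<^sup>2 / 8)) * ennreal (exp (l * (g x - E))) \<partial>PiM J M)"
  proof (intro nn_integral_mono mult_right_mono)
    fix x assume x: "x \<in> space (PiM J M)"
    show "(\<integral>\<^sup>+y. exp (l * (f (x(i := y)) - g x)) \<partial>M i) \<le> ennreal (exp (l\<^sup>2 * (c i)\<^sup>2 / 8))"
      using interval_bounded_random_variable.Hoeffdings_lemma_nn_integral[OF bounded[OF x] \<open>l > 0\<close>]
      by (simp add: g_def)
  qed simp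
  also have "\<dots> = ennreal (exp (l\<^sup>2 * (c i)\<^sup>2 / 8)) * (\<integral>\<^sup>+x. exp (l * (g x - E)) \<partial>PiM J M)"
    by (intro nn_integral_cmult) measurable
  also have "\<dots> \<le> ennreal (exp (l\<^sup>2 * (c i)\<^sup>2 / 8)) * ennreal (exp (l\<^sup>2 * (\<Sum>j\<in>J. (c j)\<^sup>2) / 8))"
    unfolding E_eq by (intro mult_left_mono insert.IH g_meas g_diff) auto
  also have "\<dots> = ennreal (exp (l\<^sup>2 * (\<Sum>j\<in>insert i J. (c j)\<^sup>2) / 8))"
    using insert.hyps
    by (simp add: ennreal_mult[symmetric] exp_add[symmetric] field_simps)
  finally show ?case unfolding E_def .
qed

theorem McDiarmid_ineq_ge:
  fixes f :: "('i \<Rightarrow> 'a) \<Rightarrow> real"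
  assumes "finite J" and [measurable]: "f \<in> borel_measurable (PiM J M)"
    and "\<And>x i y. x \<in> space (PiM J M) \<Longrightarrow> i \<in> J \<Longrightarrow> y \<in> space (M i) \<Longrightarrow>
      \<bar>f x - f (x(i := y))\<bar> \<le> c i"
    and "\<epsilon> > 0" and "(\<Sum>i\<in>J. (c i)\<^sup>2) > 0"
  shows "measure (PiM J M) {x \<in> space (PiM J M). f x \<ge> (\<integral>z. f z \<partial>PiM J M) + \<epsilon>}
    \<le> exp (- 2 * \<epsilon>\<^sup>2 / (\<Sum>i\<in>J. (c i)\<^sup>2))"
proof -
  interpret Q: prob_space "PiM J M" by (rule prob_space_PiM_subset)
  define E where "E = (\<integral>z. f z \<partial>PiM J M)"
  define d where "d = (\<Sum>i\<in>J. (c i)\<^sup>2)"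
  \<comment> \<open>This value minimises the exponent
    \<open>- l * \<epsilon> + l\<^sup>2 * d / 8\<close> of the Chernoff bound; the minimum is
    \<open>- 2 * \<epsilon>\<^sup>2 / d\<close>.\<close>
  define l where "l = 4 * \<epsilon> / d"
  have "d > 0" "l > 0" using assms(4,5) by (auto simp: d_def l_def)
  have "{x \<in> space (PiM J M). f x \<ge> E + \<epsilon>} = {x \<in> space (PiM J M). f x - E \<ge> \<epsilon>}"
    by (simp add: algebra_simps)
  then have "ennreal (Q.prob {x \<in> space (PiM J M). f x \<ge> E + \<epsilon>}) = emeasure (PiM J M) \<dots>"
    by (simp add: Q.emeasure_eq_measure)
  also have "\<dots> \<le> ennreal (exp (- l * \<epsilon>)) *
      (\<integral>\<^sup>+x\<in>space (PiM J M). exp (l * (f x - E)) \<partial>PiM J M)"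
    by (intro Chernoff_ineq_nn_integral_ge \<open>l > 0\<close>) auto
  also have "(\<integral>\<^sup>+x\<in>space (PiM J M). exp (l * (f x - E)) \<partial>PiM J M)
      = (\<integral>\<^sup>+x. exp (l * (f x - E)) \<partial>PiM J M)"
    by (intro nn_integral_cong) auto
  also have "ennreal (exp (- l * \<epsilon>)) * \<dots> \<le> ennreal (exp (- l * \<epsilon>)) * ennreal (exp (l\<^sup>2 * d / 8))"
    unfolding E_def d_def
    by (intro mult_left_mono bounded_differences_exp_moment assms \<open>l > 0\<close>) auto
  also have "\<dots> = ennreal (exp (- 2 * \<epsilon>\<^sup>2 / d))"
    using \<open>d > 0\<close>
    by (simp add: ennreal_mult[symmetric] exp_add[symmetric] l_def field_simps power2_eq_square)
  finally show ?thesis by (simp add: E_def d_def)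
qed

end

section \<open>Bounded differences of the extended estimator\<close>

definition pair_sum :: "('a \<Rightarrow> 'a \<Rightarrow> real) \<Rightarrow> (nat \<Rightarrow> 'a) \<Rightarrow> nat set \<Rightarrow> real" where
  "pair_sum d x I = (\<Sum>(i, j) \<in> {(i, j). i \<in> I \<and> j \<in> I \<and> i < j}. d (x i) (x j))"

lemma finite_ordered_pairs: "finite I \<Longrightarrow> finite {(i, j). i \<in> I \<and> j \<in> I \<and> (i::nat) < j}"
  by (rule finite_subset[of _ "I \<times> I"]) auto

lemma pair_sum_empty [simp]: "pair_sum d x {} = 0"
  by (simp add: pair_sum_def)

text \<open>The new pairs consist of \<open>i\<close> and some \<open>j\<close> in \<open>I\<close>,
  listed as \<open>(min i j, max i j)\<close>. Symmetry of \<open>d\<close> makes it irrelevant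
  which of the two indices is smaller.\<close>

lemma pair_sum_insert:
  assumes "finite I" "i \<notin> I" and sym: "\<And>a b. d a b = d b a"
  shows "pair_sum d x (insert i I) = pair_sum d x I + (\<Sum>j\<in>I. d (x i) (x j))"
proof -
  let ?h = "\<lambda>j. (min i j, max i j)"
  have inj: "inj_on ?h I"
    by (auto simp: inj_on_def min_def max_def split: if_splits)
  have mem: "(a, b) \<in> ?h ` I \<longleftrightarrow> a < b \<and> (a = i \<and> b \<in> I \<or> b = i \<and> a \<in> I)" for a b
  proof
    assume "a < b \<and> (a = i \<and> b \<in> I \<or> b = i \<and> a \<in> I)"
    then have "(a, b) = ?h b \<and> b \<in> I \<or> (a, b) = ?h a \<and> a \<in> I" by auto
    then show "(a, b) \<in> ?h ` I" by blast
  next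
    assume "(a, b) \<in> ?h ` I"
    then obtain j where j: "j \<in> I" "a = min i j" "b = max i j" by auto
    moreover have "j \<noteq> i" using assms(2) j by auto
    ultimately show "a < b \<and> (a = i \<and> b \<in> I \<or> b = i \<and> a \<in> I)"
      by (cases "i < j") auto
  qed
  have "{(a, b). a \<in> insert i I \<and> b \<in> insert i I \<and> a < b}
      = {(a, b). a \<in> I \<and> b \<in> I \<and> a < b} \<union> ?h ` I" (is "?A = ?B \<union> _")
  proof (rule set_eqI)
    fix p
    show "p \<in> ?A \<longleftrightarrow> p \<in> ?B \<union> ?h ` I"
    proof (cases p)
      case (Pair a b)
      have "(a, b) \<in> ?A \<longleftrightarrow> (a, b) \<in> ?B \<or> a < b \<and> (a = i \<and> b \<in> I \<or> b = i \<and> a \<in> I)"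
        by auto
      then show ?thesis unfolding Pair Un_iff mem .
    qed
  qed
  moreover have "?B \<inter> ?h ` I = {}"
    using \<open>i \<notin> I\<close> by (auto simp: min_def max_def split: if_splits)
  ultimately have "pair_sum d x (insert i I)
      = pair_sum d x I + (\<Sum>(a, b)\<in>?h ` I. d (x a) (x b))"
    unfolding pair_sum_def using assms(1)
    by (simp add: sum.union_disjoint finite_ordered_pairs)
  also have "(\<Sum>(a, b)\<in>?h ` I. d (x a) (x b)) = (\<Sum>j\<in>I. d (x i) (x j))"
    by (subst sum.reindex[OF inj]) (auto intro!: sum.cong simp: min_def max_def sym)
  finally show ?thesis .
qed

lemma pair_sum_cong: "(\<And>i. i \<in> I \<Longrightarrow> x i = x' i) \<Longrightarrow> pair_sum d x I = pair_sum d x' I"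
  unfolding pair_sum_def by (intro sum.cong) auto

text \<open>Counts the pairs; this serves both to subtract a constant from the distance and to sum
  equal expectations.\<close>

lemma pair_sum_const: "finite I \<Longrightarrow> pair_sum (\<lambda>_ _. r) x I = r * real (card I choose 2)"
  by (induction I rule: finite_induct)
     (auto simp: pair_sum_insert choose_two numeral_2_eq_2 algebra_simps)

lemma pair_sum_diff_const:
  assumes "finite I"
  shows "pair_sum (\<lambda>a b. d a b - r) x I = pair_sum d x I - r * real (card I choose 2)"
  using pair_sum_const[OF assms, of r x]
  by (simp add: pair_sum_def case_prod_unfold sum_subtractf)

lemma pair_sum_bounds:
  assumes "finite I" and d: "\<And>a b. 0 \<le> d a b \<and> d a b \<le> 1"
  shows "0 \<le> pair_sum d x I" "pair_sum d x I \<le> real (card I choose 2)"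
proof -
  show "0 \<le> pair_sum d x I"
    unfolding pair_sum_def using d by (intro sum_nonneg) auto
  have "pair_sum d x I \<le> pair_sum (\<lambda>_ _. 1) x I"
    unfolding pair_sum_def using d by (intro sum_mono) auto
  then show "pair_sum d x I \<le> real (card I choose 2)"
    using assms(1) by (simp add: pair_sum_const)
qed

section \<open>The contribution of one class and its change when a point is added\<close>

lemma real_choose_two: "real (n choose 2) = real n * (real n - 1) / 2"
  by (cases n) (simp_all add: choose_two real_of_nat_div field_simps)

text \<open>Equals \<open>card I\<close> times the average distance when \<open>card I \<ge> 2\<close>. Otherwise \<open>\<theta>\<close> stands in for the
  undefined average (the division by zero at \<open>card I = 1\<close> is harmless because the sum is empty).\<close>

definition class_term :: "('a \<Rightarrow> 'a \<Rightarrow> real) \<Rightarrow> real \<Rightarrow> (nat \<Rightarrow> 'a) \<Rightarrow> nat set \<Rightarrow> real" where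
  "class_term d \<theta> x I =
    real (card I) * \<theta> + 2 / (real (card I) - 1) * pair_sum (\<lambda>a b. d a b - \<theta>) x I"

lemma class_term_cong: "(\<And>i. i \<in> I \<Longrightarrow> x i = x' i) \<Longrightarrow> class_term d \<theta> x I = class_term d \<theta> x' I"
  unfolding class_term_def using pair_sum_cong[of I x x'] by simp

text \<open>The stand-in \<open>\<theta>\<close> cancels: with m points, centring subtracts 2 / (m -
  1) times m (m - 1) / 2 copies of it, which is exactly the m copies in the first summand.\<close>

lemma class_term_ge_2:
  assumes "card I \<ge> 2"
  shows "class_term d \<theta> x I = 2 / (real (card I) - 1) * pair_sum d x I"
proof -
  have "finite I" using assms card.infinite[of I] by fastforce
  then show ?thesis
    using assms by (simp add: class_term_def pair_sum_diff_const real_choose_two field_simps)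
qed

text \<open>Both endpoints come from a difference of the form 2 u - v with u and v in [0, 1]: u is
  the mean distance from the new point to the class and v the old class average, or
  \<open>\<theta>\<close> for a class of one point. An empty class changes by
  \<open>\<theta>\<close> alone.\<close>

lemma class_term_insert_bounds:
  assumes "finite I" "i \<notin> I" and sym: "\<And>a b. d a b = d b a"
    and d: "\<And>a b. 0 \<le> d a b \<and> d a b \<le> 1" and \<theta>: "0 \<le> \<theta>" "\<theta> \<le> 1"
  shows "class_term d \<theta> x (insert i I) - class_term d \<theta> x I \<in> {-1..2}"
proof -
  have s: "0 \<le> (\<Sum>j\<in>I. d (x i) (x j))" "(\<Sum>j\<in>I. d (x i) (x j)) \<le> real (card I)"
    using d sum_nonneg[of I "\<lambda>j. d (x i) (x j)"] sum_bounded_above[of I "\<lambda>j. d (x i) (x j)" 1] by auto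
  have ins: "card (insert i I) = Suc (card I)" using assms by simp
  consider "card I = 0" | "card I = 1" | "card I \<ge> 2" by linarith
  then show ?thesis
  proof cases
    case 1
    then have "I = {}" using assms by simp
    then show ?thesis using \<theta> pair_sum_insert[of "{}" i "\<lambda>a b. d a b - \<theta>" x] sym
      by (simp add: class_term_def)
  next
    \<comment> \<open>The single point counts as \<open>\<theta>\<close> and the resulting pair as
      twice its distance.\<close>
    case 2
    then obtain j where I: "I = {j}" by (auto simp: card_1_singleton_iff)
    have "pair_sum d x I = 0"
      unfolding I by (auto simp: pair_sum_def intro!: sum.neutral)
    moreover have "class_term d \<theta> x (insert i I) = 2 * pair_sum d x (insert i I)"
      using ins 2 by (subst class_term_ge_2) auto
    moreover have "class_term d \<theta> x I = \<theta>" using 2 by (simp add: class_term_def)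
    ultimately show ?thesis
      using s 2 \<theta> assms by (simp add: pair_sum_insert)
  next
    case 3
    let ?m = "real (card I)" and ?S = "pair_sum d x I" and ?s = "\<Sum>j\<in>I. d (x i) (x j)"
    have m: "?m \<ge> 2" using 3 by simp
    have "class_term d \<theta> x (insert i I) - class_term d \<theta> x I = 2 / ?m * (?S + ?s) - 2 / (?m - 1) * ?S"
      using ins 3 assms by (simp add: class_term_ge_2 pair_sum_insert)
    \<comment> \<open>The coefficient of the old pair sum is 2 / m - 2 / (m - 1) = - 2 / (m (m -
      1)), so the old pairs enter through minus their average.\<close>
    also have "\<dots> = 2 * (?s / ?m) - ?S / (?m * (?m - 1) / 2)"
      using m by (simp add: field_simps)
    finally have eq: "class_term d \<theta> x (insert i I) - class_term d \<theta> x I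
      = 2 * (?s / ?m) - ?S / (?m * (?m - 1) / 2)" .
    have "0 \<le> ?s / ?m" "?s / ?m \<le> 1" using s m by auto
    moreover have "0 \<le> ?S / (?m * (?m - 1) / 2)" "?S / (?m * (?m - 1) / 2) \<le> 1"
      using pair_sum_bounds[where d = d and x = x, OF assms(1) d] m
      by (auto simp: real_choose_two divide_le_eq_1)
    ultimately show ?thesis unfolding eq by simp
  qed
qed

text \<open>A sample point carries its own label, read off by \<open>lab\<close>. The weight n_k / n
  is split: \<open>class_term\<close> already contains the factor n_k, and only the division by
  \<open>n\<close> remains.\<close>

definition relaxed_est ::
  "('s \<Rightarrow> 's \<Rightarrow> real) \<Rightarrow> ('s \<Rightarrow> 'l) \<Rightarrow> 'l set \<Rightarrow> ('l \<Rightarrow> real) \<Rightarrow> nat \<Rightarrow> (nat \<Rightarrow> 's) \<Rightarrow> real" where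
  "relaxed_est d lab \<Lambda> \<theta> n z =
    pair_sum d z {1..n} / real (n choose 2)
    - (\<Sum>l\<in>\<Lambda>. class_term d (\<theta> l) z {i \<in> {1..n}. lab (z i) = l}) / real n"

text \<open>The old and the new sample both arise from the common subsample \<open>J\<close> by
  adding one point at index \<open>i\<close>, so each is compared with the value on
  \<open>J\<close>.\<close>

lemma relaxed_est_bounded_differences:
  assumes "finite \<Lambda>" and sym: "\<And>a b. d a b = d b a"
    and d: "\<And>a b. 0 \<le> d a b \<and> d a b \<le> 1"
    and \<theta>: "\<And>l. l \<in> \<Lambda> \<Longrightarrow> 0 \<le> \<theta> l \<and> \<theta> l \<le> 1"
    and n: "n \<ge> 2" and i: "i \<in> {1..n}"
  shows "\<bar>relaxed_est d lab \<Lambda> \<theta> n z - relaxed_est d lab \<Lambda> \<theta> n (z(i := w))\<bar> \<le> 5 / real n"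
proof -
  define J where "J = {1..n} - {i}"
  have J: "finite J" "i \<notin> J" "insert i J = {1..n}" "real (card J) = real n - 1"
    using i by (auto simp: J_def)
  define A where "A v = pair_sum d v {1..n}" for v
  define C where "C v = (\<Sum>l\<in>\<Lambda>. class_term d (\<theta> l) v {i \<in> {1..n}. lab (v i) = l})" for v
  define C0 where "C0 = (\<Sum>l\<in>\<Lambda>. class_term d (\<theta> l) z {j \<in> J. lab (z j) = l})"
  have C: "C v - C0 \<in> {-1..2}" if v: "\<And>j. j \<in> J \<Longrightarrow> v j = z j" for v
  proof -
    define T where "T l = class_term d (\<theta> l) v {i \<in> {1..n}. lab (v i) = l}
      - class_term d (\<theta> l) z {j \<in> J. lab (z j) = l}" for l
    have Jl: "{j \<in> J. lab (z j) = l} = {j \<in> J. lab (v j) = l}" for l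
      using v by auto
    have T_eq: "T l = class_term d (\<theta> l) v {j \<in> insert i J. lab (v j) = l}
      - class_term d (\<theta> l) v {j \<in> J. lab (v j) = l}" for l
      unfolding T_def Jl J(3)
      using class_term_cong[of "{j \<in> J. lab (v j) = l}" z v d "\<theta> l"] v by simp
    have T0: "T l = 0" if "l \<noteq> lab (v i)" for l
    proof -
      have "{j \<in> insert i J. lab (v j) = l} = {j \<in> J. lab (v j) = l}"
        using that by auto
      then show ?thesis by (simp add: T_eq)
    qed
    have T1: "T (lab (v i)) \<in> {-1..2}" if "lab (v i) \<in> \<Lambda>"
    proof -
      have *: "{j \<in> insert i J. lab (v j) = lab (v i)} = insert i {j \<in> J. lab (v j) = lab (v i)}"
        by auto
      show ?thesis
        unfolding T_eq * by (intro class_term_insert_bounds) (use J sym d \<theta> that in auto)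
    qed
    have "C v - C0 = (\<Sum>l\<in>\<Lambda>. T l)"
      by (simp add: C_def C0_def T_def sum_subtractf)
    \<comment> \<open>Only the class that receives the new point changes. A label outside
      \<open>\<Lambda>\<close> changes nothing, and 0 lies in the interval as well.\<close>
    also have "\<dots> = (if lab (v i) \<in> \<Lambda> then T (lab (v i)) else 0)"
    proof -
      have "(\<Sum>l\<in>\<Lambda>. T l) = (\<Sum>l\<in>\<Lambda>. if l = lab (v i) then T l else 0)"
        using T0 by (intro sum.cong) auto
      then show ?thesis using \<open>finite \<Lambda>\<close> by simp
    qed
    finally show ?thesis using T1 by auto
  qed
  have A_eq: "A v = pair_sum d z J + (\<Sum>j\<in>J. d (v i) (z j))" if v: "\<And>j. j \<in> J \<Longrightarrow> v j = z j" for v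
    using pair_sum_insert[where d = d and x = v, OF J(1,2) sym] pair_sum_cong[of J v z d] v
    by (simp add: A_def J(3))
  have s: "0 \<le> (\<Sum>j\<in>J. d (v i) (z j))" "(\<Sum>j\<in>J. d (v i) (z j)) \<le> real n - 1" for v
    using d sum_nonneg[of J "\<lambda>j. d (v i) (z j)"] sum_bounded_above[of J "\<lambda>j. d (v i) (z j)" 1] J(4)
    by auto
  let ?z' = "z(i := w)"
  have z': "\<And>j. j \<in> J \<Longrightarrow> ?z' j = z j" using J by auto
  have "\<bar>A z - A ?z'\<bar> \<le> real n - 1"
    using A_eq[of z, OF refl] A_eq[OF z'] s[of z] s[of ?z'] by linarith
  then have "\<bar>A z - A ?z'\<bar> / real (n choose 2) \<le> (real n - 1) / real (n choose 2)"
    by (rule divide_right_mono) simp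
  \<comment> \<open>Of the n (n - 1) / 2 pairs, only the n - 1 pairs that contain \<open>i\<close>
    are affected.\<close>
  also have "\<dots> = 2 / real n"
    using n by (simp add: real_choose_two divide_simps)
  finally have 1: "\<bar>A z / real (n choose 2) - A ?z' / real (n choose 2)\<bar> \<le> 2 / real n"
    by (simp add: diff_divide_distrib[symmetric])
  \<comment> \<open>Both deviations from \<open>C0\<close> lie in an interval of length 3. Keeping
    their signs matters: absolute values alone would give 4.\<close>
  have "\<bar>C z - C ?z'\<bar> \<le> 3"
    using C[of z, OF refl] C[OF z'] unfolding atLeastAtMost_iff by linarith
  then have "\<bar>C z - C ?z'\<bar> / real n \<le> 3 / real n"
    by (rule divide_right_mono) simp
  then have 2: "\<bar>C z / real n - C ?z' / real n\<bar> \<le> 3 / real n"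
    by (simp add: diff_divide_distrib[symmetric])
  have 3: "5 / real n = 2 / real n + 3 / real n" by (simp add: add_divide_distrib[symmetric])
  have "relaxed_est d lab \<Lambda> \<theta> n v = A v / real (n choose 2) - C v / real n" for v
    by (simp add: relaxed_est_def A_def C_def)
  then show ?thesis using 1 2 unfolding 3 by simp
qed

section \<open>Expectation and tails of the extended estimator\<close>

lemma real_card_filter: "finite A \<Longrightarrow> real (card {i \<in> A. P i}) = (\<Sum>i\<in>A. of_bool (P i))"
  by (simp only: card_eq_sum of_nat_sum of_nat_1 of_bool_def sum.inter_filter) (auto intro!: sum.cong)

text \<open>Trades the sample-dependent index set of a class for indicators over a fixed set of
  pairs, so that measurability and expectation can be treated pair by pair.\<close>

lemma pair_sum_filter:
  assumes "finite A"
  shows "pair_sum d z {i \<in> A. P i}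
    = (\<Sum>(i, j) \<in> {(i, j). i \<in> A \<and> j \<in> A \<and> i < j}. of_bool (P i \<and> P j) * d (z i) (z j))"
proof -
  have "{(i, j). i \<in> {i \<in> A. P i} \<and> j \<in> {i \<in> A. P i} \<and> i < j}
    = {p \<in> {(i, j). i \<in> A \<and> j \<in> A \<and> i < j}. case p of (i, j) \<Rightarrow> P i \<and> P j}" by auto
  then show ?thesis
    unfolding pair_sum_def
    by (simp only: sum.inter_filter finite_ordered_pairs[OF assms])
       (auto intro!: sum.cong)
qed

text \<open>\<open>N\<close> is the law of a single sample point together with its label; the sample
  is then a point of the product \<open>PiM {1..n}\<close>, the setting of McDiarmid's
  inequality.\<close>

locale labelled_law = prob_space N for N :: "'s measure" +
  fixes d :: "'s \<Rightarrow> 's \<Rightarrow> real" and lab :: "'s \<Rightarrow> 'l" and \<Lambda> :: "'l set"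
  assumes finite_labels: "finite \<Lambda>"
    and d_sym: "\<And>a b. d a b = d b a"
    and d_bounds: "\<And>a b. 0 \<le> d a b \<and> d a b \<le> 1"
    and d_measurable [measurable]: "(\<lambda>(a, b). d a b) \<in> borel_measurable (N \<Otimes>\<^sub>M N)"
    and lab_measurable [measurable]: "lab \<in> measurable N (count_space \<Lambda>)"
begin

sublocale law: product_prob_space "\<lambda>_::nat. N" UNIV
  by unfold_locales

lemma prob_space_sample: "prob_space (PiM J (\<lambda>_. N))"
  by (intro prob_space_PiM prob_space_axioms)

lemma d_coords_measurable [measurable]:
  assumes [measurable]: "f \<in> measurable M N" "g \<in> measurable M N"
  shows "(\<lambda>x. d (f x) (g x)) \<in> borel_measurable M"
  using measurable_compose[OF measurable_Pair[OF assms] d_measurable] by simp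

lemma lab_pred [measurable]: "Measurable.pred N (\<lambda>s. lab s = l)"
proof (cases "l \<in> \<Lambda>")
  case True
  have "lab -` {l} \<inter> space N \<in> sets N"
    by (rule measurable_sets[OF lab_measurable]) (use True in auto)
  also have "lab -` {l} \<inter> space N = {s \<in> space N. lab s = l}" by auto
  finally show ?thesis by (simp add: pred_def)
next
  case False
  then have "\<And>s. s \<in> space N \<Longrightarrow> lab s \<noteq> l"
    using measurable_space[OF lab_measurable] by auto
  then show ?thesis by (subst measurable_cong[of _ _ "\<lambda>_. False"]) auto
qed

text \<open>Coordinates \<open>i\<close> and \<open>j\<close> are integrated out first. The
  hypothesis \<open>factor\<close> separates their joint contribution \<open>e\<close> from the rest
  \<open>\<psi>\<close>, so independence turns the integral into a product; the bound
  \<open>B\<close> provides integrability at both stages.\<close>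

lemma integral_two_coords:
  fixes F :: "(nat \<Rightarrow> 's) \<Rightarrow> real"
  assumes J: "finite J" "i \<notin> J" "j \<notin> J" "i \<noteq> j"
    and F [measurable]: "F \<in> borel_measurable (PiM (insert i (insert j J)) (\<lambda>_. N))"
    and B: "\<And>z. \<bar>F z\<bar> \<le> B"
    and factor: "\<And>z a b. z \<in> space (PiM J (\<lambda>_. N)) \<Longrightarrow> a \<in> space N \<Longrightarrow> b \<in> space N \<Longrightarrow>
      F (z(j := b, i := a)) = e a b * \<psi> z"
  shows "(\<integral>z. F z \<partial>PiM (insert i (insert j J)) (\<lambda>_. N))
    = (\<integral>b. \<integral>a. e a b \<partial>N \<partial>N) * (\<integral>z. \<psi> z \<partial>PiM J (\<lambda>_. N))"
proof -
  interpret P1: prob_space "PiM (insert i (insert j J)) (\<lambda>_. N)" by (rule prob_space_sample)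
  interpret P2: prob_space "PiM (insert j J) (\<lambda>_. N)" by (rule prob_space_sample)
  define g where "g z = (\<integral>a. F (z(i := a)) \<partial>N)" for z
  have F_upd [measurable]: "(\<lambda>p. F ((fst p)(i := snd p)))
      \<in> borel_measurable (PiM (insert j J) (\<lambda>_. N) \<Otimes>\<^sub>M N)"
    using measurable_compose[OF measurable_add_dim F] by (simp add: case_prod_unfold)
  have g_meas [measurable]: "g \<in> borel_measurable (PiM (insert j J) (\<lambda>_. N))"
    unfolding g_def by measurable
  have g_bound: "\<bar>g z\<bar> \<le> B" if z: "z \<in> space (PiM (insert j J) (\<lambda>_. N))" for z
  proof -
    have [measurable]: "(\<lambda>a. F (z(i := a))) \<in> borel_measurable N"
      using measurable_compose[OF measurable_Pair1'[OF z] F_upd] by simp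
    have int: "integrable N (\<lambda>a. F (z(i := a)))"
      by (rule integrable_const_bound[of _ B]) (use B in auto)
    have "g z \<le> B" "- B \<le> g z"
      unfolding g_def using B[THEN abs_le_D1] B[THEN abs_le_D2]
      by (auto intro!: integral_le_const integral_ge_const int AE_I2 simp: minus_le_iff)
    then show ?thesis by simp
  qed
  have "(\<integral>z. F z \<partial>PiM (insert i (insert j J)) (\<lambda>_. N)) = (\<integral>z. g z \<partial>PiM (insert j J) (\<lambda>_. N))"
    unfolding g_def
    by (intro law.product_integral_insert P1.integrable_const_bound[of _ B]) (use B J in auto)
  also have "\<dots> = (\<integral>z. \<integral>b. g (z(j := b)) \<partial>N \<partial>PiM J (\<lambda>_. N))"
    by (intro law.product_integral_insert P2.integrable_const_bound[of _ B] AE_I2)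
       (use g_bound J in auto)
  also have "\<dots> = (\<integral>z. (\<integral>b. \<integral>a. e a b \<partial>N \<partial>N) * \<psi> z \<partial>PiM J (\<lambda>_. N))"
  proof (intro Bochner_Integration.integral_cong refl)
    fix z assume z: "z \<in> space (PiM J (\<lambda>_. N))"
    have "(\<integral>b. g (z(j := b)) \<partial>N) = (\<integral>b. (\<integral>a. e a b \<partial>N) * \<psi> z \<partial>N)"
      unfolding g_def
      by (intro Bochner_Integration.integral_cong refl)
         (subst integral_mult_left_zero[symmetric],
          intro Bochner_Integration.integral_cong refl factor z)
    then show "(\<integral>b. g (z(j := b)) \<partial>N) = (\<integral>b. \<integral>a. e a b \<partial>N \<partial>N) * \<psi> z" by simp
  qed
  finally show ?thesis by simp
qed

section \<open>Class membership and the contribution of a single pair\<close>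

lemma coord_measurable: "i \<in> J \<Longrightarrow> (\<lambda>z. z i) \<in> measurable (PiM J (\<lambda>_. N)) N"
  by (rule measurable_component_singleton)

lemma lab_coord_pred: "i \<in> J \<Longrightarrow> Measurable.pred (PiM J (\<lambda>_. N)) (\<lambda>z. lab (z i) = l)"
  by (rule measurable_compose[OF coord_measurable lab_pred])

lemma class_card_measurable:
  assumes "finite A" "A \<subseteq> J"
  shows "(\<lambda>z. real (card {i \<in> A. lab (z i) = l})) \<in> borel_measurable (PiM J (\<lambda>_. N))"
  unfolding real_card_filter[OF assms(1)] of_bool_def
  by (intro borel_measurable_sum measurable_If lab_coord_pred[unfolded pred_def])
     (use assms(2) in auto)

text \<open>The share of the pair \<open>(i, j)\<close> in \<open>class_term\<close>. Its weight
  involves the class size and hence depends on the whole sample, not only on the two points.\<close>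

definition class_summand ::
  "nat \<Rightarrow> 'l \<Rightarrow> real \<Rightarrow> nat \<Rightarrow> nat \<Rightarrow> (nat \<Rightarrow> 's) \<Rightarrow> real" where
  "class_summand n l t i j z = of_bool (lab (z i) = l \<and> lab (z j) = l) * (d (z i) (z j) - t)
    * (2 / (real (card {i \<in> {1..n}. lab (z i) = l}) - 1))"

lemma class_term_eq_summands:
  "class_term d t z {i \<in> {1..n}. lab (z i) = l} =
    (\<Sum>i\<in>{1..n}. of_bool (lab (z i) = l)) * t
    + (\<Sum>(i, j) \<in> {(i, j). i \<in> {1..n} \<and> j \<in> {1..n} \<and> i < j}. class_summand n l t i j z)"
proof -
  let ?c = "2 / (real (card {i \<in> {1..n}. lab (z i) = l}) - 1)"
  have "?c * pair_sum (\<lambda>a b. d a b - t) z {i \<in> {1..n}. lab (z i) = l}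
    = (\<Sum>(i, j) \<in> {(i, j). i \<in> {1..n} \<and> j \<in> {1..n} \<and> i < j}. class_summand n l t i j z)"
    unfolding pair_sum_filter[OF finite_atLeastAtMost] sum_distrib_left
    by (intro sum.cong refl) (simp only: class_summand_def case_prod_unfold mult.commute)
  then show ?thesis
    unfolding class_term_def by (simp only: real_card_filter[OF finite_atLeastAtMost])
qed

lemma class_summand_measurable:
  assumes "i \<in> {1..n}" "j \<in> {1..n}"
  shows "class_summand n l t i j \<in> borel_measurable (PiM {1..n} (\<lambda>_. N))"
proof -
  have "Measurable.pred (PiM {1..n} (\<lambda>_. N)) (\<lambda>z. lab (z i) = l \<and> lab (z j) = l)"
    by (intro pred_intros_logic lab_coord_pred assms)
  then show ?thesis
    unfolding class_summand_def[abs_def] of_bool_def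
    by (intro borel_measurable_times borel_measurable_divide borel_measurable_diff measurable_If
        d_coords_measurable coord_measurable class_card_measurable assms) (auto simp: pred_def)
qed

text \<open>Where the indicator is nonzero, the class contains both \<open>i\<close> and
  \<open>j\<close>, so its size minus 1 is at least 1 and the weight is at most 2. The bound serves
  integrability.\<close>

lemma class_summand_bound:
  assumes "0 \<le> t" "t \<le> 1" "i \<in> {1..n}" "j \<in> {1..n}" "i \<noteq> j"
  shows "\<bar>class_summand n l t i j z\<bar> \<le> 2"
proof (cases "lab (z i) = l \<and> lab (z j) = l")
  case True
  have "card {i, j} \<le> card {i \<in> {1..n}. lab (z i) = l}"
    using True assms by (intro card_mono) auto
  then have "real (card {i \<in> {1..n}. lab (z i) = l}) \<ge> 2" using assms(5) by simp
  then have "\<bar>2 / (real (card {i \<in> {1..n}. lab (z i) = l}) - 1)\<bar> \<le> 2"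
    by (simp add: abs_le_iff divide_le_eq)
  moreover have "\<bar>d (z i) (z j) - t\<bar> \<le> 1"
    using d_bounds[of "z i" "z j"] assms(1,2) by (simp add: abs_le_iff)
  ultimately have "\<bar>d (z i) (z j) - t\<bar> * \<bar>2 / (real (card {i \<in> {1..n}. lab (z i) = l}) - 1)\<bar> \<le> 1 * 2"
    by (intro mult_mono) auto
  moreover have "class_summand n l t i j z
      = (d (z i) (z j) - t) * (2 / (real (card {i \<in> {1..n}. lab (z i) = l}) - 1))"
    using True by (simp add: class_summand_def)
  ultimately show ?thesis by (simp only: abs_mult)
qed (auto simp: class_summand_def)

text \<open>On the event that \<open>i\<close> and \<open>j\<close> both have label
  \<open>l\<close>, the class size is 2 plus the number of other points in the class. The weight is
  thus a function of the other coordinates, and the mean factors through the vanishing mean of the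
  centred distance.\<close>

lemma integral_class_summand:
  assumes t: "0 \<le> t" "t \<le> 1" and ij: "i \<in> {1..n}" "j \<in> {1..n}" "i \<noteq> j"
    and centred: "(\<integral>b. \<integral>a. of_bool (lab a = l \<and> lab b = l) * (d a b - t) \<partial>N \<partial>N) = 0"
  shows "(\<integral>z. class_summand n l t i j z \<partial>PiM {1..n} (\<lambda>_. N)) = 0"
proof -
  define J where "J = {1..n} - {i, j}"
  have J: "finite J" "i \<notin> J" "j \<notin> J" "insert i (insert j J) = {1..n}"
    using ij by (auto simp: J_def)
  have "(\<integral>z. class_summand n l t i j z \<partial>PiM (insert i (insert j J)) (\<lambda>_. N))
    = (\<integral>b. \<integral>a. of_bool (lab a = l \<and> lab b = l) * (d a b - t) \<partial>N \<partial>N)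
      * (\<integral>z. 2 / (real (card {k \<in> J. lab (z k) = l}) + 1) \<partial>PiM J (\<lambda>_. N))"
  proof (rule integral_two_coords[where B = 2])
    fix z a b assume "z \<in> space (PiM J (\<lambda>_. N))"
    define w where "w = z(j := b, i := a)"
    have "real (card {k \<in> {1..n}. lab (w k) = l}) - 1 = real (card {k \<in> J. lab (z k) = l}) + 1"
      if "lab a = l" "lab b = l"
    proof -
      have "{k \<in> {1..n}. lab (w k) = l} = insert i (insert j {k \<in> J. lab (z k) = l})"
        using J that ij unfolding J(4)[symmetric] by (auto simp: w_def)
      then show ?thesis using J ij by simp
    qed
    then show "class_summand n l t i j w
      = of_bool (lab a = l \<and> lab b = l) * (d a b - t) * (2 / (real (card {k \<in> J. lab (z k) = l}) + 1))"
      using ij(3) unfolding class_summand_def by (cases "lab a = l \<and> lab b = l") (auto simp: w_def)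
  next
    show "class_summand n l t i j \<in> borel_measurable (PiM (insert i (insert j J)) (\<lambda>_. N))"
      unfolding J(4) by (rule class_summand_measurable[OF ij(1,2)])
  qed (use J ij t class_summand_bound in auto)
  then show ?thesis using centred J(4) by simp
qed

lemma integral_d_coords:
  fixes i j n :: nat
  assumes ij: "i \<in> {1..n}" "j \<in> {1..n}" "i \<noteq> j"
  shows "(\<integral>z. d (z i) (z j) \<partial>PiM {1..n} (\<lambda>_. N)) = (\<integral>b. \<integral>a. d a b \<partial>N \<partial>N)"
proof -
  define J where "J = {1..n} - {i, j}"
  have J: "finite J" "i \<notin> J" "j \<notin> J" "insert i (insert j J) = {1..n}"
    using ij by (auto simp: J_def)
  interpret PJ: prob_space "PiM J (\<lambda>_. N)" by (rule prob_space_sample)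
  have "(\<integral>z. d (z i) (z j) \<partial>PiM (insert i (insert j J)) (\<lambda>_. N))
    = (\<integral>b. \<integral>a. d a b \<partial>N \<partial>N) * (\<integral>z. 1 \<partial>PiM J (\<lambda>_. N))"
  proof (rule integral_two_coords[where B = 1])
    show "(\<lambda>z. d (z i) (z j)) \<in> borel_measurable (PiM (insert i (insert j J)) (\<lambda>_. N))"
      by (intro d_coords_measurable coord_measurable) auto
  qed (use J ij d_bounds in auto)
  then show ?thesis using J(4) by (simp add: PJ.prob_space)
qed

lemma integral_lab_coord:
  fixes i n :: nat
  assumes "i \<in> {1..n}"
  shows "(\<integral>z. of_bool (lab (z i) = l) \<partial>PiM {1..n} (\<lambda>_. N)) = prob {s \<in> space N. lab s = l}"
proof -
  have "(\<integral>z. (of_bool (lab (z i) = l) :: real) \<partial>PiM {1..n} (\<lambda>_. N))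
    = (\<integral>s. of_bool (lab s = l) \<partial>distr (PiM {1..n} (\<lambda>_. N)) N (\<lambda>z. z i))"
    using assms by (subst integral_distr) (auto simp: of_bool_def)
  also have "distr (PiM {1..n} (\<lambda>_. N)) N (\<lambda>z. z i) = N"
    using assms by (intro distr_PiM_component prob_space_axioms) auto
  also have "(\<integral>s. of_bool (lab s = l) \<partial>N) = (\<integral>s. indicator {s \<in> space N. lab s = l} s \<partial>N)"
    by (intro Bochner_Integration.integral_cong) (auto simp: indicator_def)
  finally show ?thesis by simp
qed

section \<open>Mean and concentration of the extended estimator\<close>

lemma relaxed_est_measurable:
  "relaxed_est d lab \<Lambda> \<theta> n \<in> borel_measurable (PiM {1..n} (\<lambda>_. N))"
proof -
  have "(\<lambda>z. class_term d (\<theta> l) z {i \<in> {1..n}. lab (z i) = l}) \<in> borel_measurable (PiM {1..n} (\<lambda>_. N))"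
    for l
    unfolding class_term_eq_summands of_bool_def case_prod_unfold
    by (intro borel_measurable_add borel_measurable_times borel_measurable_sum measurable_If
        lab_coord_pred[unfolded pred_def] class_summand_measurable) auto
  moreover have "(\<lambda>z. pair_sum d z {1..n}) \<in> borel_measurable (PiM {1..n} (\<lambda>_. N))"
    unfolding pair_sum_def case_prod_unfold
    by (intro borel_measurable_sum d_coords_measurable coord_measurable) auto
  ultimately show ?thesis
    unfolding relaxed_est_def[abs_def]
    by (intro borel_measurable_diff borel_measurable_divide borel_measurable_sum) auto
qed

text \<open>All pairs have the same mean distance. In the class terms the centred summands vanish in
  the mean, which leaves \<open>\<theta> l\<close> times the expected class size, \<open>n\<close>
  times the probability of \<open>l\<close>.\<close>

lemma integral_relaxed_est:
  assumes n: "n \<ge> 2" and \<theta>: "\<And>l. l \<in> \<Lambda> \<Longrightarrow> 0 \<le> \<theta> l \<and> \<theta> l \<le> 1"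
    and centred: "\<And>l. l \<in> \<Lambda> \<Longrightarrow>
      (\<integral>b. \<integral>a. of_bool (lab a = l \<and> lab b = l) * (d a b - \<theta> l) \<partial>N \<partial>N) = 0"
  shows "(\<integral>z. relaxed_est d lab \<Lambda> \<theta> n z \<partial>PiM {1..n} (\<lambda>_. N))
    = (\<integral>b. \<integral>a. d a b \<partial>N \<partial>N) - (\<Sum>l\<in>\<Lambda>. prob {s \<in> space N. lab s = l} * \<theta> l)"
proof -
  let ?P = "PiM {1..n} (\<lambda>_. N)" and ?\<mu> = "\<integral>b. \<integral>a. d a b \<partial>N \<partial>N"
  let ?pairs = "{p. fst p \<in> {1..n} \<and> snd p \<in> {1..n} \<and> fst p < snd p}"
  interpret P: prob_space ?P by (rule prob_space_sample)
  have int_d: "integrable ?P (\<lambda>z. d (z i) (z j))" if "i \<in> {1..n}" "j \<in> {1..n}" for i j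
    by (intro P.integrable_const_bound[of _ 1] AE_I2 d_coords_measurable coord_measurable that)
       (use d_bounds in auto)
  have int_lab: "integrable ?P (\<lambda>z. of_bool (lab (z i) = l) :: real)" if "i \<in> {1..n}" for i l
    unfolding of_bool_def
    by (intro P.integrable_const_bound[of _ 1] AE_I2 measurable_If
        lab_coord_pred[unfolded pred_def] that) auto
  have int_s: "integrable ?P (class_summand n l (\<theta> l) i j)"
    if "i \<in> {1..n}" "j \<in> {1..n}" "i \<noteq> j" "l \<in> \<Lambda>" for i j l
    by (intro P.integrable_const_bound[of _ 2] AE_I2 class_summand_measurable that)
       (use class_summand_bound \<theta> that in auto)
  have int_pair: "integrable ?P (\<lambda>z. pair_sum d z {1..n})"
    unfolding pair_sum_def case_prod_unfold
    by (intro Bochner_Integration.integrable_sum int_d) auto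
  have "(\<integral>z. pair_sum d z {1..n} \<partial>?P) = (\<Sum>p\<in>?pairs. \<integral>z. d (z (fst p)) (z (snd p)) \<partial>?P)"
    unfolding pair_sum_def case_prod_unfold
    by (intro Bochner_Integration.integral_sum int_d) auto
  also have "\<dots> = (\<Sum>p\<in>?pairs. ?\<mu>)"
    by (intro sum.cong refl integral_d_coords) auto
  \<comment> \<open>The sum of equal terms is read as a constant \<open>pair_sum\<close> to count
    the pairs; the sample argument is arbitrary because a constant ignores it.\<close>
  also have "\<dots> = pair_sum (\<lambda>_ _. ?\<mu>) (undefined :: nat \<Rightarrow> 's) {1..n}"
    by (simp add: pair_sum_def case_prod_unfold)
  also have "\<dots> = ?\<mu> * real (n choose 2)"
    by (simp add: pair_sum_const)
  finally have pair: "(\<integral>z. pair_sum d z {1..n} \<partial>?P) = ?\<mu> * real (n choose 2)" .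
  have term_l: "integrable ?P (\<lambda>z. class_term d (\<theta> l) z {i \<in> {1..n}. lab (z i) = l})"
      "(\<integral>z. class_term d (\<theta> l) z {i \<in> {1..n}. lab (z i) = l} \<partial>?P)
        = real n * (prob {s \<in> space N. lab s = l} * \<theta> l)" if l: "l \<in> \<Lambda>" for l
  proof -
    have i1: "integrable ?P (\<lambda>z. (\<Sum>i\<in>{1..n}. of_bool (lab (z i) = l)) * \<theta> l)"
      by (intro integrable_mult_left Bochner_Integration.integrable_sum int_lab)
    have i2: "integrable ?P (\<lambda>z. \<Sum>p\<in>?pairs. class_summand n l (\<theta> l) (fst p) (snd p) z)"
      by (intro Bochner_Integration.integrable_sum int_s l) auto
    show "integrable ?P (\<lambda>z. class_term d (\<theta> l) z {i \<in> {1..n}. lab (z i) = l})"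
      unfolding class_term_eq_summands case_prod_unfold
      using i1 i2 by (rule Bochner_Integration.integrable_add)
    have "(\<integral>z. (\<Sum>p\<in>?pairs. class_summand n l (\<theta> l) (fst p) (snd p) z) \<partial>?P)
      = (\<Sum>p\<in>?pairs. \<integral>z. class_summand n l (\<theta> l) (fst p) (snd p) z \<partial>?P)"
      by (intro Bochner_Integration.integral_sum int_s l) auto
    also have "\<dots> = 0"
      using \<theta>[OF l] centred[OF l] by (intro sum.neutral ballI integral_class_summand) auto
    finally have e2: "(\<integral>z. (\<Sum>p\<in>?pairs. class_summand n l (\<theta> l) (fst p) (snd p) z) \<partial>?P) = 0" .
    have "(\<integral>z. (\<Sum>i\<in>{1..n}. of_bool (lab (z i) = l) :: real) \<partial>?P)
      = (\<Sum>i\<in>{1..n}. \<integral>z. of_bool (lab (z i) = l) \<partial>?P)"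
      by (intro Bochner_Integration.integral_sum int_lab)
    also have "\<dots> = (\<Sum>i\<in>{1..n}. prob {s \<in> space N. lab s = l})"
      by (intro sum.cong refl integral_lab_coord)
    also have "\<dots> = real n * prob {s \<in> space N. lab s = l}" by simp
    finally have "(\<integral>z. (\<Sum>i\<in>{1..n}. of_bool (lab (z i) = l)) * \<theta> l \<partial>?P)
      = real n * (prob {s \<in> space N. lab s = l} * \<theta> l)"
      by simp
    then show "(\<integral>z. class_term d (\<theta> l) z {i \<in> {1..n}. lab (z i) = l} \<partial>?P)
        = real n * (prob {s \<in> space N. lab s = l} * \<theta> l)"
      unfolding class_term_eq_summands case_prod_unfold
      using e2 by (subst Bochner_Integration.integral_add[OF i1 i2]) simp
  qed
  have "(\<integral>z. relaxed_est d lab \<Lambda> \<theta> n z \<partial>?P)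
    = (\<integral>z. pair_sum d z {1..n} / real (n choose 2) \<partial>?P)
      - (\<integral>z. (\<Sum>l\<in>\<Lambda>. class_term d (\<theta> l) z {i \<in> {1..n}. lab (z i) = l}) / real n \<partial>?P)"
    unfolding relaxed_est_def
    by (intro Bochner_Integration.integral_diff integrable_divide Bochner_Integration.integrable_sum
        int_pair term_l)
  also have "(\<integral>z. (\<Sum>l\<in>\<Lambda>. class_term d (\<theta> l) z {i \<in> {1..n}. lab (z i) = l}) / real n \<partial>?P)
      = (\<Sum>l\<in>\<Lambda>. \<integral>z. class_term d (\<theta> l) z {i \<in> {1..n}. lab (z i) = l} \<partial>?P) / real n"
    using term_l by (simp add: Bochner_Integration.integral_sum)
  also have "\<dots> = (\<Sum>l\<in>\<Lambda>. prob {s \<in> space N. lab s = l} * \<theta> l)"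
    using term_l n by (simp add: sum_distrib_left[symmetric])
  also have "(\<integral>z. pair_sum d z {1..n} / real (n choose 2) \<partial>?P) = ?\<mu>"
    using pair n by simp
  finally show ?thesis .
qed

text \<open>The squared differences \<open>(5 / n)\<^sup>2\<close> add up to 25 / n over the
  \<open>n\<close> coordinates. The lower tail is the upper tail of \<open>- f\<close>.\<close>

lemma relaxed_est_tails:
  assumes n: "n \<ge> 2" and \<theta>: "\<And>l. l \<in> \<Lambda> \<Longrightarrow> 0 \<le> \<theta> l \<and> \<theta> l \<le> 1" and "\<epsilon> > 0"
  defines "f \<equiv> relaxed_est d lab \<Lambda> \<theta> n" and "P \<equiv> PiM {1..n} (\<lambda>_. N)"
  shows "measure P {z \<in> space P. f z \<ge> (\<integral>z. f z \<partial>P) + \<epsilon>} \<le> exp (- 2 * real n * \<epsilon>\<^sup>2 / 25)"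
    and "measure P {z \<in> space P. f z \<le> (\<integral>z. f z \<partial>P) - \<epsilon>} \<le> exp (- 2 * real n * \<epsilon>\<^sup>2 / 25)"
proof -
  have f: "f \<in> borel_measurable P"
    unfolding f_def P_def by (rule relaxed_est_measurable)
  have diff: "\<bar>f z - f (z(i := w))\<bar> \<le> 5 / real n" if "i \<in> {1..n}" for z i w
    unfolding f_def
    by (rule relaxed_est_bounded_differences[OF finite_labels d_sym d_bounds \<theta> n that])
  have exponent: "- 2 * \<epsilon>\<^sup>2 / (\<Sum>i\<in>{1..n}. (5 / real n)\<^sup>2) = - 2 * real n * \<epsilon>\<^sup>2 / 25"
    using n by (simp add: power2_eq_square)
  have pos: "0 < (\<Sum>i\<in>{1..n}. (5 / real n)\<^sup>2)"
    using n by simp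
  show "measure P {z \<in> space P. f z \<ge> (\<integral>z. f z \<partial>P) + \<epsilon>} \<le> exp (- 2 * real n * \<epsilon>\<^sup>2 / 25)"
    unfolding exponent[symmetric] unfolding P_def
    by (rule law.McDiarmid_ineq_ge) (use f diff pos \<open>\<epsilon> > 0\<close> in \<open>auto simp: P_def\<close>)
  have "measure P {z \<in> space P. - f z \<ge> (\<integral>z. - f z \<partial>P) + \<epsilon>} \<le> exp (- 2 * real n * \<epsilon>\<^sup>2 / 25)"
    unfolding exponent[symmetric] unfolding P_def
  proof (rule law.McDiarmid_ineq_ge)
    show "\<bar>- f z - - f (z(i := w))\<bar> \<le> 5 / real n" if "i \<in> {1..n}" for z i w
      using diff[OF that, of z w] by linarith
  qed (use f pos \<open>\<epsilon> > 0\<close> in \<open>auto simp: P_def\<close>)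
  moreover have "{z \<in> space P. - f z \<ge> (\<integral>z. - f z \<partial>P) + \<epsilon>} = {z \<in> space P. f z \<le> (\<integral>z. f z \<partial>P) - \<epsilon>}"
    by auto
  ultimately show "measure P {z \<in> space P. f z \<le> (\<integral>z. f z \<partial>P) - \<epsilon>} \<le> exp (- 2 * real n * \<epsilon>\<^sup>2 / 25)"
    by simp
qed

end

section \<open>The Gini distance covariance\<close>

text \<open>Second countability identifies the product of the Borel sigma-algebras with the Borel
  sigma-algebra of the product space, where continuity of the kernel gives measurability.\<close>

lemma kernel_dist_measurable:
  fixes \<kappa> :: "'a::second_countable_topology \<Rightarrow> 'a \<Rightarrow> real"
  assumes "mercer_kernel \<kappa>"
  shows "(\<lambda>(x, x'). kernel_dist \<kappa> x x') \<in> borel_measurable (borel \<Otimes>\<^sub>M borel)"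
proof -
  have \<kappa>: "(\<lambda>(x, x'). \<kappa> x x') \<in> borel_measurable (borel \<Otimes>\<^sub>M borel)"
    using assms unfolding mercer_kernel_def borel_prod by (intro borel_measurable_continuous_onI) auto
  have [measurable]: "(\<lambda>p. \<kappa> (f p) (g p)) \<in> borel_measurable (borel \<Otimes>\<^sub>M borel)"
    if "f \<in> measurable (borel \<Otimes>\<^sub>M borel) borel" "g \<in> measurable (borel \<Otimes>\<^sub>M borel) borel"
    for f g :: "'a \<times> 'a \<Rightarrow> 'a"
    using measurable_compose[OF measurable_Pair[OF that] \<kappa>] by simp
  show ?thesis
    unfolding kernel_dist_def case_prod_unfold by measurable
qed

text \<open>Conditioning on an event of positive probability is a change of density to the
  normalised indicator.\<close>

lemma integral_cond_law:
  fixes f :: "'a::topological_space \<Rightarrow> real"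
  assumes "prob_space M" and X [measurable]: "X \<in> borel_measurable M"
    and A [measurable]: "{\<omega> \<in> space M. Y \<omega> = l} \<in> sets M"
    and pos: "\<P>(\<omega> in M. Y \<omega> = l) > 0" and f [measurable]: "f \<in> borel_measurable borel"
  shows "(\<integral>x. f x \<partial>cond_law M X Y l)
    = (\<integral>\<omega>. of_bool (Y \<omega> = l) * f (X \<omega>) \<partial>M) / \<P>(\<omega> in M. Y \<omega> = l)"
proof -
  interpret prob_space M by fact
  let ?A = "{\<omega> \<in> space M. Y \<omega> = l}"
  have "(\<integral>x. f x \<partial>cond_law M X Y l) = (\<integral>\<omega>. f (X \<omega>) \<partial>uniform_measure M ?A)"
    unfolding cond_law_def by (rule integral_distr) auto
  also have "uniform_measure M ?A = density M (\<lambda>\<omega>. ennreal (indicator ?A \<omega> / prob ?A))"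
    unfolding uniform_measure_def
    using pos by (intro density_cong AE_I2)
      (auto simp: emeasure_eq_measure indicator_def divide_ennreal[symmetric])
  also have "(\<integral>\<omega>. f (X \<omega>) \<partial>\<dots>) = (\<integral>\<omega>. (indicator ?A \<omega> / prob ?A) *\<^sub>R f (X \<omega>) \<partial>M)"
    by (rule integral_density) auto
  also have "\<dots> = (\<integral>\<omega>. of_bool (Y \<omega> = l) * f (X \<omega>) / prob ?A \<partial>M)"
    by (intro Bochner_Integration.integral_cong) (auto simp: indicator_def)
  finally show ?thesis by simp
qed

locale labelled_variable = prob_space M for M :: "'w measure" +
  fixes X :: "'w \<Rightarrow> 'a::second_countable_topology" and Y :: "'w \<Rightarrow> 'l"
    and L :: "nat \<Rightarrow> 'l" and K :: nat and \<kappa> :: "'a \<Rightarrow> 'a \<Rightarrow> real"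
  assumes X_measurable [measurable]: "X \<in> borel_measurable M"
    and Y_measurable [measurable]: "Y \<in> measurable M (count_space (L ` {1..K}))"
    and L_inj: "inj_on L {1..K}"
    and class_pos: "\<And>k. k \<in> {1..K} \<Longrightarrow> \<P>(\<omega> in M. Y \<omega> = L k) > 0"
    and mercer: "mercer_kernel \<kappa>"
    and kernel_dist_bounds: "\<And>x x'. 0 \<le> kernel_dist \<kappa> x x' \<and> kernel_dist \<kappa> x x' \<le> 1"
begin

declare One_nat_def [simp del]

abbreviation "labels \<equiv> L ` {1..K}"
abbreviation "sample_space \<equiv> (borel :: 'a measure) \<Otimes>\<^sub>M count_space labels"
definition "joint_law = distr M sample_space (\<lambda>\<omega>. (X \<omega>, Y \<omega>))"
text \<open>The value substituted for \<open>\<theta>\<close>: the true mean distance within the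
  class, which is what makes the class terms centred.\<close>

definition "class_mean_dist l = mean_dist \<kappa> (cond_law M X Y l) (cond_law M X Y l)"

lemma kernel_dist_sym: "kernel_dist \<kappa> x x' = kernel_dist \<kappa> x' x"
  using mercer by (simp add: mercer_kernel_def kernel_dist_def add.commute)

lemma kernel_dist_coords_measurable [measurable]:
  assumes "f \<in> measurable T borel" "g \<in> measurable T borel"
  shows "(\<lambda>z. kernel_dist \<kappa> (f z) (g z)) \<in> borel_measurable T"
  using measurable_compose[OF measurable_Pair[OF assms] kernel_dist_measurable[OF mercer]] by simp

lemma Y_label: "\<omega> \<in> space M \<Longrightarrow> Y \<omega> \<in> labels"
  using measurable_space[OF Y_measurable] by auto

lemma Y_class_sets:
  assumes "l \<in> labels"
  shows "{\<omega> \<in> space M. Y \<omega> = l} \<in> sets M"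
proof -
  have "Y -` {l} \<inter> space M \<in> sets M"
    by (rule measurable_sets[OF Y_measurable]) (use assms in auto)
  also have "Y -` {l} \<inter> space M = {\<omega> \<in> space M. Y \<omega> = l}" by auto
  finally show ?thesis .
qed

lemma joint_measurable [measurable]: "(\<lambda>\<omega>. (X \<omega>, Y \<omega>)) \<in> measurable M sample_space"
  by measurable

lemma prob_space_cond_law:
  assumes "l \<in> labels"
  shows "prob_space (cond_law M X Y l)"
proof -
  have "prob_space (uniform_measure M {\<omega> \<in> space M. Y \<omega> = l})"
    using assms by (intro prob_space_uniform_measure) (auto simp: emeasure_eq_measure dest: class_pos)
  then show ?thesis
    unfolding cond_law_def by (rule prob_space.prob_space_distr) simp
qed

lemma sets_cond_law [simp, measurable_cong]: "sets (cond_law M X Y l) = sets borel"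
  by (simp add: cond_law_def)

lemma mean_dist_iterated:
  assumes "prob_space P" "prob_space Q"
    and [measurable_cong]: "sets P = sets borel" "sets Q = sets borel"
  shows "mean_dist \<kappa> P Q = (\<integral>x. \<integral>x'. kernel_dist \<kappa> x x' \<partial>Q \<partial>P)"
proof -
  interpret P: prob_space P by fact
  interpret Q: prob_space Q by fact
  interpret PQ: pair_prob_space P Q ..
  have "integrable (P \<Otimes>\<^sub>M Q) (\<lambda>(x, x'). kernel_dist \<kappa> x x')"
    unfolding case_prod_unfold
    by (rule PQ.integrable_const_bound[of _ 1]) (use kernel_dist_bounds in \<open>auto\<close>)
  from PQ.integral_fst'[OF this] show ?thesis
    by (simp add: mean_dist_def)
qed

lemma integral_joint_class:
  fixes f :: "'a \<Rightarrow> real"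
  assumes l: "l \<in> labels" and [measurable]: "f \<in> borel_measurable borel"
  shows "(\<integral>a. of_bool (snd a = l) * f (fst a) \<partial>joint_law)
    = \<P>(\<omega> in M. Y \<omega> = l) * (\<integral>x. f x \<partial>cond_law M X Y l)"
proof -
  have [measurable]: "Measurable.pred sample_space (\<lambda>a. snd a = l)"
    by (rule measurable_compose[OF measurable_snd])
       (use l in \<open>auto simp: pred_def\<close>)
  have pos: "\<P>(\<omega> in M. Y \<omega> = l) > 0" using l class_pos by auto
  have "(\<integral>a. of_bool (snd a = l) * f (fst a) \<partial>joint_law) = (\<integral>\<omega>. of_bool (Y \<omega> = l) * f (X \<omega>) \<partial>M)"
    unfolding joint_law_def of_bool_def by (subst integral_distr) (auto)
  then show ?thesis
    using integral_cond_law[OF prob_space_axioms X_measurable Y_class_sets[OF l] pos] pos by simp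
qed

text \<open>The law of total expectation, that is, F is the mixture of the conditional laws: every
  outcome has a label, and injectivity of \<open>L\<close> makes exactly one indicator equal to
  1.\<close>

lemma integral_total:
  fixes f :: "'a \<Rightarrow> real"
  assumes [measurable]: "f \<in> borel_measurable borel" and B: "\<And>x. \<bar>f x\<bar> \<le> B"
  shows "(\<Sum>k\<in>{1..K}. \<P>(\<omega> in M. Y \<omega> = L k) * (\<integral>x. f x \<partial>cond_law M X Y (L k)))
    = (\<integral>x. f x \<partial>distr M borel X)"
proof -
  have int: "integrable M (\<lambda>\<omega>. of_bool (Y \<omega> = L k) * f (X \<omega>))" if "k \<in> {1..K}" for k
  proof (rule integrable_const_bound[of _ B])
    have [measurable]: "Measurable.pred M (\<lambda>\<omega>. Y \<omega> = L k)"
      using Y_class_sets that by (simp add: pred_def)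
    show "(\<lambda>\<omega>. of_bool (Y \<omega> = L k) * f (X \<omega>)) \<in> borel_measurable M"
      unfolding of_bool_def by measurable
    have "0 \<le> B" using B[of undefined] by linarith
    then show "AE \<omega> in M. norm (of_bool (Y \<omega> = L k) * f (X \<omega>)) \<le> B"
      using B by (intro AE_I2) auto
  qed
  have "\<P>(\<omega> in M. Y \<omega> = L k) * (\<integral>x. f x \<partial>cond_law M X Y (L k))
    = (\<integral>\<omega>. of_bool (Y \<omega> = L k) * f (X \<omega>) \<partial>M)" if "k \<in> {1..K}" for k
    using integral_cond_law[OF prob_space_axioms X_measurable Y_class_sets class_pos[OF that], of f]
      class_pos[OF that] that by simp
  then have "(\<Sum>k\<in>{1..K}. \<P>(\<omega> in M. Y \<omega> = L k) * (\<integral>x. f x \<partial>cond_law M X Y (L k)))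
    = (\<integral>\<omega>. (\<Sum>k\<in>{1..K}. of_bool (Y \<omega> = L k) * f (X \<omega>)) \<partial>M)"
    by (subst Bochner_Integration.integral_sum) (auto intro!: sum.cong int)
  also have "\<dots> = (\<integral>\<omega>. f (X \<omega>) \<partial>M)"
  proof (intro Bochner_Integration.integral_cong refl)
    fix \<omega> assume "\<omega> \<in> space M"
    then obtain k where k: "k \<in> {1..K}" "Y \<omega> = L k" using Y_label by blast
    have "(\<Sum>j\<in>{1..K}. of_bool (Y \<omega> = L j) * f (X \<omega>)) = (\<Sum>j\<in>{1..K}. if j = k then f (X \<omega>) else 0)"
      unfolding k(2) using k(1) by (intro sum.cong) (auto simp: inj_on_eq_iff[OF L_inj])
    then show "(\<Sum>j\<in>{1..K}. of_bool (Y \<omega> = L j) * f (X \<omega>)) = f (X \<omega>)"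
      using k by simp
  qed
  finally show ?thesis by (simp add: integral_distr)
qed

lemma prob_space_marginal: "prob_space (distr M borel X)"
  by (rule prob_space_distr) simp

text \<open>With \<open>h x\<close> the mean distance from \<open>x\<close> to an independent copy
  of X, the cross terms average to the overall mean distance by total expectation. Twice that mean
  minus once that mean leaves the second form of the covariance.\<close>

lemma gini_cov_eq:
  "gini_cov \<kappa> M X Y L K = mean_dist \<kappa> (distr M borel X) (distr M borel X)
    - (\<Sum>k\<in>{1..K}. \<P>(\<omega> in M. Y \<omega> = L k) * class_mean_dist (L k))"
proof -
  let ?F = "distr M borel X" and ?p = "\<lambda>k. \<P>(\<omega> in M. Y \<omega> = L k)"
  interpret F: prob_space ?F by (rule prob_space_marginal)
  define h where "h x = (\<integral>x'. kernel_dist \<kappa> x x' \<partial>?F)" for x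
  have h_meas: "h \<in> borel_measurable borel"
    unfolding h_def by measurable
  have int: "integrable ?F (\<lambda>x'. kernel_dist \<kappa> x x')" for x
    by (rule F.integrable_const_bound[of _ 1]) (use kernel_dist_bounds in auto)
  have h_bound: "\<bar>h x\<bar> \<le> 1" for x
  proof -
    have "0 \<le> h x" "h x \<le> 1"
      unfolding h_def using kernel_dist_bounds
      by (auto intro!: F.integral_le_const F.integral_ge_const int AE_I2)
    then show ?thesis by simp
  qed
  have mean: "mean_dist \<kappa> (cond_law M X Y (L k)) ?F = (\<integral>x. h x \<partial>cond_law M X Y (L k))"
    if "k \<in> {1..K}" for k
    unfolding h_def using that
    by (intro mean_dist_iterated prob_space_cond_law prob_space_marginal) auto
  have mean_F: "mean_dist \<kappa> ?F ?F = (\<integral>x. h x \<partial>?F)"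
    unfolding h_def by (intro mean_dist_iterated prob_space_marginal) auto
  have cross: "(\<Sum>k\<in>{1..K}. ?p k * mean_dist \<kappa> (cond_law M X Y (L k)) ?F) = mean_dist \<kappa> ?F ?F"
    unfolding mean_F using integral_total[OF h_meas h_bound] mean by simp
  \<comment> \<open>Total expectation of the constant 1 shows that the class probabilities sum to
    1.\<close>
  have "(\<Sum>k\<in>{1..K}. ?p k * (\<integral>x. 1 \<partial>cond_law M X Y (L k))) = (\<integral>x. 1 \<partial>?F)"
    by (rule integral_total[where B = 1]) auto
  moreover have "(\<integral>x. 1 \<partial>cond_law M X Y (L k)) = (1::real)" if "k \<in> {1..K}" for k
    using prob_space.prob_space[OF prob_space_cond_law[of "L k"]] that by simp
  ultimately have total: "(\<Sum>k\<in>{1..K}. ?p k) = 1"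
    using F.prob_space by simp
  have "gini_cov \<kappa> M X Y L K
    = 2 * (\<Sum>k\<in>{1..K}. ?p k * mean_dist \<kappa> (cond_law M X Y (L k)) ?F)
      - (\<Sum>k\<in>{1..K}. ?p k * class_mean_dist (L k)) - (\<Sum>k\<in>{1..K}. ?p k) * mean_dist \<kappa> ?F ?F"
    unfolding gini_cov_def Let_def class_mean_dist_def sum_distrib_left sum_distrib_right
      sum_subtractf[symmetric]
    by (intro sum.cong refl) (simp add: algebra_simps)
  then show ?thesis unfolding cross total by simp
qed

sublocale joint: labelled_law joint_law "\<lambda>a b. kernel_dist \<kappa> (fst a) (fst b)" snd labels
proof -
  interpret J: prob_space joint_law
    unfolding joint_law_def by (rule prob_space_distr) simp
  show "labelled_law joint_law (\<lambda>a b. kernel_dist \<kappa> (fst a) (fst b)) snd labels"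
  proof
    have [measurable_cong]: "sets joint_law = sets sample_space"
      by (simp add: joint_law_def)
    show "(\<lambda>(a, b). kernel_dist \<kappa> (fst a) (fst b)) \<in> borel_measurable (joint_law \<Otimes>\<^sub>M joint_law)"
      unfolding case_prod_unfold by measurable
    show "snd \<in> measurable joint_law (count_space labels)"
      by measurable
  qed (use kernel_dist_sym kernel_dist_bounds in auto)
qed

lemma class_mean_dist_bounds:
  assumes "l \<in> labels"
  shows "0 \<le> class_mean_dist l \<and> class_mean_dist l \<le> 1"
proof -
  interpret Q: prob_space "cond_law M X Y l" by (rule prob_space_cond_law[OF assms])
  interpret QQ: pair_prob_space "cond_law M X Y l" "cond_law M X Y l" ..
  let ?Q = "cond_law M X Y l \<Otimes>\<^sub>M cond_law M X Y l"
  have int: "integrable ?Q (\<lambda>(x, x'). kernel_dist \<kappa> x x')"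
    unfolding case_prod_unfold
    by (rule QQ.integrable_const_bound[of _ 1]) (use kernel_dist_bounds in auto)
  then show ?thesis
    unfolding class_mean_dist_def mean_dist_def using kernel_dist_bounds
    by (auto intro!: QQ.integral_le_const QQ.integral_ge_const AE_I2)
qed

text \<open>Restricting two independent points to label \<open>l\<close> gives two independent draws
  from the conditional law, up to the squared class probability; the mean distance of such draws is
  \<open>class_mean_dist l\<close> itself.\<close>

lemma class_centred:
  assumes l: "l \<in> labels"
  shows "(\<integral>b. \<integral>a. of_bool (snd a = l \<and> snd b = l) *
    (kernel_dist \<kappa> (fst a) (fst b) - class_mean_dist l) \<partial>joint_law \<partial>joint_law) = 0"
proof -
  let ?Q = "cond_law M X Y l" and ?p = "\<P>(\<omega> in M. Y \<omega> = l)" and ?t = "class_mean_dist l"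
  interpret Q: prob_space ?Q by (rule prob_space_cond_law[OF l])
  define h where "h y = (\<integral>x. kernel_dist \<kappa> x y - ?t \<partial>?Q)" for y
  have h_meas: "h \<in> borel_measurable borel"
    unfolding h_def by measurable
  have int: "integrable ?Q (\<lambda>x. kernel_dist \<kappa> x y)" for y
    by (rule Q.integrable_const_bound[of _ 1]) (use kernel_dist_bounds in auto)
  have h_eq: "h y = (\<integral>x. kernel_dist \<kappa> y x \<partial>?Q) - ?t" for y
    unfolding h_def kernel_dist_sym[of y] using int
    by (subst Bochner_Integration.integral_diff) (auto simp: Q.prob_space)
  have "(\<integral>a. of_bool (snd a = l \<and> snd b = l) * (kernel_dist \<kappa> (fst a) (fst b) - ?t) \<partial>joint_law)
    = of_bool (snd b = l) * (?p * h (fst b))" for b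
  proof (cases "snd b = l")
    case True
    then show ?thesis
      using integral_joint_class[OF l, of "\<lambda>x. kernel_dist \<kappa> x (fst b) - ?t"]
      by (simp add: h_def)
  qed simp
  then have "(\<integral>b. \<integral>a. of_bool (snd a = l \<and> snd b = l) *
      (kernel_dist \<kappa> (fst a) (fst b) - ?t) \<partial>joint_law \<partial>joint_law)
    = (\<integral>b. of_bool (snd b = l) * (?p * h (fst b)) \<partial>joint_law)"
    by simp
  also have "\<dots> = ?p * (\<integral>y. ?p * h y \<partial>?Q)"
    using h_meas by (intro integral_joint_class l) simp
  also have "(\<integral>y. ?p * h y \<partial>?Q) = ?p * (\<integral>y. h y \<partial>?Q)" by simp
  also have "(\<integral>y. h y \<partial>?Q) = (\<integral>y. (\<integral>x. kernel_dist \<kappa> y x \<partial>?Q) \<partial>?Q) - ?t"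
  proof -
    have "integrable ?Q h"
    proof (rule Q.integrable_const_bound[of _ 1])
      have "\<bar>h y\<bar> \<le> 1" for y
      proof -
        have "0 \<le> (\<integral>x. kernel_dist \<kappa> x y \<partial>?Q)" "(\<integral>x. kernel_dist \<kappa> x y \<partial>?Q) \<le> 1"
          using kernel_dist_bounds
          by (auto intro!: Q.integral_le_const Q.integral_ge_const int AE_I2)
        then show ?thesis
          using class_mean_dist_bounds[OF l] unfolding h_eq kernel_dist_sym[of y] by linarith
      qed
      then show "AE y in ?Q. norm (h y) \<le> 1" by simp
    qed (use h_meas in simp)
    then have "integrable ?Q (\<lambda>y. h y + ?t)" by simp
    then have "integrable ?Q (\<lambda>y. \<integral>x. kernel_dist \<kappa> y x \<partial>?Q)" unfolding h_eq by simp
    then show ?thesis unfolding h_eq by (simp add: Q.prob_space)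
  qed
  also have "\<dots> = 0"
    unfolding class_mean_dist_def
    using mean_dist_iterated[OF Q.prob_space_axioms Q.prob_space_axioms] by simp
  finally show ?thesis by simp
qed

lemma prob_joint_label:
  assumes "l \<in> labels"
  shows "joint.prob {s \<in> space joint_law. snd s = l} = \<P>(\<omega> in M. Y \<omega> = l)"
proof -
  have "{s \<in> space joint_law. snd s = l} \<in> sets sample_space"
    using joint.lab_pred[of l] by (simp add: pred_def joint_law_def)
  then have "joint.prob {s \<in> space joint_law. snd s = l}
    = prob ((\<lambda>\<omega>. (X \<omega>, Y \<omega>)) -` {s \<in> space joint_law. snd s = l} \<inter> space M)"
    by (subst (1) joint_law_def) (rule measure_distr[OF joint_measurable])
  also have "(\<lambda>\<omega>. (X \<omega>, Y \<omega>)) -` {s \<in> space joint_law. snd s = l} \<inter> space M = {\<omega> \<in> space M. Y \<omega> = l}"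
    using Y_label by (auto simp: joint_law_def space_pair_measure)
  finally show ?thesis .
qed

lemma integral_joint_dist:
  "(\<integral>b. \<integral>a. kernel_dist \<kappa> (fst a) (fst b) \<partial>joint_law \<partial>joint_law)
    = mean_dist \<kappa> (distr M borel X) (distr M borel X)"
proof -
  have marg: "(\<integral>a. f (fst a) \<partial>joint_law) = (\<integral>x. f x \<partial>distr M borel X)"
    if [measurable]: "f \<in> borel_measurable borel" for f :: "'a \<Rightarrow> real"
    unfolding joint_law_def by (simp add: integral_distr)
  interpret F: prob_space "distr M borel X" by (rule prob_space_marginal)
  have "(\<integral>b. \<integral>a. kernel_dist \<kappa> (fst a) (fst b) \<partial>joint_law \<partial>joint_law)
    = (\<integral>b. (\<integral>x. kernel_dist \<kappa> x (fst b) \<partial>distr M borel X) \<partial>joint_law)"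
    by (intro Bochner_Integration.integral_cong refl marg) measurable
  also have "\<dots> = (\<integral>y. (\<integral>x. kernel_dist \<kappa> x y \<partial>distr M borel X) \<partial>distr M borel X)"
    by (rule marg) measurable
  also have "\<dots> = (\<integral>y. (\<integral>x. kernel_dist \<kappa> y x \<partial>distr M borel X) \<partial>distr M borel X)"
    by (simp only: kernel_dist_sym)
  also have "\<dots> = mean_dist \<kappa> (distr M borel X) (distr M borel X)"
    by (rule mean_dist_iterated[symmetric]) (auto intro: prob_space_marginal)
  finally show ?thesis .
qed

section \<open>From the extended estimator to the estimator on the original probability
  space\<close>

abbreviation "relaxed \<equiv> relaxed_est (\<lambda>a b. kernel_dist \<kappa> (fst a) (fst b)) snd labels class_mean_dist"

lemma integral_relaxed:
  assumes "n \<ge> 2"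
  shows "(\<integral>z. relaxed n z \<partial>PiM {1..n} (\<lambda>_. joint_law)) = gini_cov \<kappa> M X Y L K"
proof -
  have "(\<integral>z. relaxed n z \<partial>PiM {1..n} (\<lambda>_. joint_law))
    = mean_dist \<kappa> (distr M borel X) (distr M borel X)
      - (\<Sum>l\<in>labels. joint.prob {s \<in> space joint_law. snd s = l} * class_mean_dist l)"
    unfolding integral_joint_dist[symmetric]
    by (rule joint.integral_relaxed_est[OF assms class_mean_dist_bounds class_centred])
  also have "\<dots> = gini_cov \<kappa> M X Y L K"
    unfolding gini_cov_eq by (simp add: sum.reindex[OF L_inj] prob_joint_label)
  finally show ?thesis .
qed

text \<open>The extension agrees with the estimator once every class has a pair: the stand-in has
  cancelled from every class term, and what remains is the class size times the class
  average.\<close>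

lemma relaxed_eq_gini_cov_est:
  assumes n: "n \<ge> 2" and z: "\<And>i. i \<in> {1..n} \<Longrightarrow> z i = (x i, y i)"
    and large: "\<And>k. k \<in> {1..K} \<Longrightarrow> card (class_idx n y (L k)) \<ge> 2"
  shows "relaxed n z = gini_cov_est \<kappa> n x y L K"
proof -
  have ps: "pair_sum (\<lambda>a b. kernel_dist \<kappa> (fst a) (fst b)) z I = pair_sum (kernel_dist \<kappa>) x I"
    if "I \<subseteq> {1..n}" for I
    unfolding pair_sum_def using that by (intro sum.cong) (auto simp: z subset_iff)
  have avg: "pair_avg \<kappa> x I = pair_sum (kernel_dist \<kappa>) x I / real (card I choose 2)" for I
    by (simp add: pair_avg_def pair_sum_def)
  have "class_term (\<lambda>a b. kernel_dist \<kappa> (fst a) (fst b)) (class_mean_dist (L k)) z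
        {i \<in> {1..n}. snd (z i) = L k} / real n
      = real (card (class_idx n y (L k))) / real n * pair_avg \<kappa> x (class_idx n y (L k))"
    if k: "k \<in> {1..K}" for k
  proof -
    have I: "{i \<in> {1..n}. snd (z i) = L k} = class_idx n y (L k)"
      using z by (auto simp: class_idx_def)
    have "class_idx n y (L k) \<subseteq> {1..n}" by (auto simp: class_idx_def)
    then show ?thesis
      using large[OF k] unfolding I
      by (auto simp: class_term_ge_2 ps avg real_choose_two divide_simps)
  qed
  then show ?thesis
    unfolding relaxed_est_def gini_cov_est_def avg sum_divide_distrib
    by (simp add: sum.reindex[OF L_inj] ps)
qed

text \<open>By independence and equality of laws, the sample has the product law, and on
  \<open>G\<close> the estimator equals its extension. The events of interest are therefore
  contained in preimages of the tail events of the extension.\<close>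

lemma gini_cov_est_tails:
  fixes xs :: "nat \<Rightarrow> 'w \<Rightarrow> 'a" and ys :: "nat \<Rightarrow> 'w \<Rightarrow> 'l"
  assumes indep: "indep_vars (\<lambda>_. sample_space) (\<lambda>i \<omega>. (xs i \<omega>, ys i \<omega>)) {1..n}"
    and law: "\<And>i. i \<in> {1..n} \<Longrightarrow> distr M sample_space (\<lambda>\<omega>. (xs i \<omega>, ys i \<omega>)) = joint_law"
    and "\<epsilon> > 0" and r: "r \<ge> gini_cov \<kappa> M X Y L K + \<epsilon>" and r': "r' \<le> gini_cov \<kappa> M X Y L K - \<epsilon>"
  defines "G \<equiv> \<lambda>\<omega>. \<forall>k\<in>{1..K}. card (class_idx n (\<lambda>i. ys i \<omega>) (L k)) > 2"
    and "est \<equiv> \<lambda>\<omega>. gini_cov_est \<kappa> n (\<lambda>i. xs i \<omega>) (\<lambda>i. ys i \<omega>) L K"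
  shows "\<P>(\<omega> in M. G \<omega> \<and> est \<omega> \<ge> r) \<le> exp (- 2 * real n * \<epsilon>\<^sup>2 / 25)" (is "prob ?U \<le> _")
    and "\<P>(\<omega> in M. G \<omega> \<and> est \<omega> \<le> r') \<le> exp (- 2 * real n * \<epsilon>\<^sup>2 / 25)" (is "prob ?D \<le> _")
proof -
  have "prob ?U \<le> exp (- 2 * real n * \<epsilon>\<^sup>2 / 25) \<and> prob ?D \<le> exp (- 2 * real n * \<epsilon>\<^sup>2 / 25)"
  proof (cases "n \<ge> 2")
    case False
    \<comment> \<open>Any outcome has a label, so at least one class exists and \<open>G\<close> is
      not vacuous; fewer than two indices cannot give it more than two members.\<close>
    have "\<not> G \<omega>" if \<omega>: "\<omega> \<in> space M" for \<omega>
    proof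
      assume "G \<omega>"
      moreover obtain k where "k \<in> {1..K}" using Y_label[OF \<omega>] by blast
      ultimately have "2 < card (class_idx n (\<lambda>i. ys i \<omega>) (L k))" by (auto simp: G_def)
      also have "\<dots> \<le> card {1..n}"
        by (rule card_mono) (auto simp: class_idx_def)
      finally show False using False by simp
    qed
    then have "?U = {}" "?D = {}" by blast+
    then show ?thesis by (simp only: measure_empty) simp
  next
    case n: True
    let ?P = "PiM {1..n} (\<lambda>_. joint_law)" and ?Z = "\<lambda>\<omega>. \<lambda>i\<in>{1..n}. (xs i \<omega>, ys i \<omega>)"
    have rv: "(\<lambda>\<omega>. (xs i \<omega>, ys i \<omega>)) \<in> measurable M sample_space" if "i \<in> {1..n}" for i
      using indep that by (auto simp: indep_vars_def)
    have "distr M (PiM {1..n} (\<lambda>_. sample_space)) ?Z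
      = PiM {1..n} (\<lambda>i. distr M sample_space (\<lambda>\<omega>. (xs i \<omega>, ys i \<omega>)))"
      using indep n by (subst indep_vars_iff_distr_eq_PiM'[symmetric]) (auto intro: rv)
    also have "\<dots> = ?P"
      by (intro PiM_cong refl law)
    finally have distr: "distr M (PiM {1..n} (\<lambda>_. sample_space)) ?Z = ?P" .
    have Z: "?Z \<in> measurable M (PiM {1..n} (\<lambda>_. sample_space))"
      by (intro measurable_restrict rv)
    \<comment> \<open>Here \<open>R\<close> compares with the given threshold and \<open>Q\<close>
      with the mean shifted by \<open>\<epsilon>\<close>. Monotonicity of the measure asks only the
      larger event, the preimage, to be measurable.\<close>
    have transfer: "prob {\<omega> \<in> space M. G \<omega> \<and> R (est \<omega>)} \<le> measure ?P {z \<in> space ?P. Q (relaxed n z)}"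
      if "\<And>v. R v \<Longrightarrow> Q v" "Measurable.pred borel Q" for R Q
    proof -
      have A: "{z \<in> space ?P. Q (relaxed n z)} \<in> sets ?P"
        using measurable_compose[OF joint.relaxed_est_measurable that(2)] by (simp add: pred_def)
      then have A': "{z \<in> space ?P. Q (relaxed n z)} \<in> sets (PiM {1..n} (\<lambda>_. sample_space))"
        unfolding distr[symmetric] by simp
      have "measure ?P {z \<in> space ?P. Q (relaxed n z)} = prob (?Z -` {z \<in> space ?P. Q (relaxed n z)} \<inter> space M)"
        unfolding distr[symmetric]
        by (rule measure_distr[OF Z]) (use A' in \<open>simp add: distr\<close>)
      moreover have "{\<omega> \<in> space M. G \<omega> \<and> R (est \<omega>)} \<subseteq> ?Z -` {z \<in> space ?P. Q (relaxed n z)} \<inter> space M"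
      proof
        fix \<omega> assume "\<omega> \<in> {\<omega> \<in> space M. G \<omega> \<and> R (est \<omega>)}"
        then have \<omega>: "\<omega> \<in> space M" "G \<omega>" "R (est \<omega>)" by auto
        have "?Z \<omega> \<in> space (distr M (PiM {1..n} (\<lambda>_. sample_space)) ?Z)"
          using measurable_space[OF Z \<omega>(1)] by simp
        then have "?Z \<omega> \<in> space ?P" unfolding distr .
        moreover have "relaxed n (?Z \<omega>) = est \<omega>"
          unfolding est_def using \<omega>(2) by (intro relaxed_eq_gini_cov_est n) (auto simp: G_def less_imp_le)
        ultimately show "\<omega> \<in> ?Z -` {z \<in> space ?P. Q (relaxed n z)} \<inter> space M"
          using \<omega>(1) that(1)[OF \<omega>(3)] by simp
      qed
      ultimately show ?thesis
        using measurable_sets[OF Z A'] by (simp add: finite_measure_mono)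
    qed
    note tails = joint.relaxed_est_tails[where \<theta> = class_mean_dist, OF n class_mean_dist_bounds \<open>\<epsilon> > 0\<close>,
        unfolded integral_relaxed[OF n]]
    show ?thesis
    proof
      show "prob ?U \<le> exp (- 2 * real n * \<epsilon>\<^sup>2 / 25)"
        by (rule order_trans[OF transfer tails(1)]) (use r in auto)
      show "prob ?D \<le> exp (- 2 * real n * \<epsilon>\<^sup>2 / 25)"
        by (rule order_trans[OF transfer tails(2)]) (use r' in auto)
    qed
  qed
  then show "prob ?U \<le> exp (- 2 * real n * \<epsilon>\<^sup>2 / 25)" "prob ?D \<le> exp (- 2 * real n * \<epsilon>\<^sup>2 / 25)"
    by auto
qed

end

theorem corollary6:
  fixes M :: "'w measure"
    and X :: "'w \<Rightarrow> real ^ 'q" and Y :: "'w \<Rightarrow> 'l"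
    and xs :: "nat \<Rightarrow> 'w \<Rightarrow> real ^ 'q" and ys :: "nat \<Rightarrow> 'w \<Rightarrow> 'l"
    and L :: "nat \<Rightarrow> 'l" and K n :: nat
    and p :: "nat \<Rightarrow> real"
    and \<kappa> :: "real ^ 'q \<Rightarrow> real ^ 'q \<Rightarrow> real"
    and c t :: real
  assumes "prob_space M"
    and "X \<in> borel_measurable M"
    and "inj_on L {1..K}"
    and "Y \<in> measurable M (count_space (L ` {1..K}))"
    and "\<And>k. k \<in> {1..K} \<Longrightarrow> \<P>(\<omega> in M. Y \<omega> = L k) = p k"
    and "\<And>k. k \<in> {1..K} \<Longrightarrow> 0 < p k \<and> p k < 1"
    and "n \<ge> 1"
    and "prob_space.indep_vars M (\<lambda>_. borel \<Otimes>\<^sub>M count_space (L ` {1..K}))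
           (\<lambda>i \<omega>. (xs i \<omega>, ys i \<omega>)) {1..n}"
    and "\<And>i. i \<in> {1..n} \<Longrightarrow>
           distr M (borel \<Otimes>\<^sub>M count_space (L ` {1..K})) (\<lambda>\<omega>. (xs i \<omega>, ys i \<omega>)) =
           distr M (borel \<Otimes>\<^sub>M count_space (L ` {1..K})) (\<lambda>\<omega>. (X \<omega>, Y \<omega>))"
    and "mercer_kernel \<kappa>"
    and "\<And>x x'. 0 \<le> kernel_dist \<kappa> x x' \<and> kernel_dist \<kappa> x x' < 1"
    and "c > 0" and "0 < t" and "t < 1 / 2"
  shows "(gini_cov \<kappa> M X Y L K = 0 \<longrightarrow>
            \<P>(\<omega> in M. (\<forall>k\<in>{1..K}. card (class_idx n (\<lambda>i. ys i \<omega>) (L k)) > 2) \<and>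
                  gini_cov_est \<kappa> n (\<lambda>i. xs i \<omega>) (\<lambda>i. ys i \<omega>) L K \<ge> c * real n powr (- t))
            \<le> exp (- (c\<^sup>2 * real n powr (1 - 2 * t) / 12.5))) \<and>
         (gini_cov \<kappa> M X Y L K \<ge> 2 * c * real n powr (- t) \<longrightarrow>
            \<P>(\<omega> in M. (\<forall>k\<in>{1..K}. card (class_idx n (\<lambda>i. ys i \<omega>) (L k)) > 2) \<and>
                  gini_cov_est \<kappa> n (\<lambda>i. xs i \<omega>) (\<lambda>i. ys i \<omega>) L K \<le> c * real n powr (- t))
            \<le> exp (- (c\<^sup>2 * real n powr (1 - 2 * t) / 12.5)))"
proof -
  interpret prob_space M by fact
  interpret labelled_variable M X Y L K \<kappa>
    by unfold_locales (use assms in \<open>auto intro: less_imp_le\<close>)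
  let ?E = "gini_cov \<kappa> M X Y L K"
  \<comment> \<open>The deviation \<open>\<epsilon>\<close> is the rejection threshold itself: under
    the null hypothesis it lies one \<open>\<epsilon>\<close> above the mean 0, under the
    alternative at least one \<open>\<epsilon>\<close> below the mean.\<close>
  have "c * real n powr (- t) > 0" using assms by simp
  note tail = gini_cov_est_tails[OF assms(8) _ this, unfolded joint_law_def, OF assms(9)]
  have "- 2 * real n * (c * real n powr (- t))\<^sup>2 / 25 = - (c\<^sup>2 * (real n * (real n powr (- t))\<^sup>2) / 12.5)"
    by (simp add: power_mult_distrib)
  also have "real n * (real n powr (- t))\<^sup>2 = real n powr (1 - 2 * t)"
    using assms(7) by (simp add: powr_add[symmetric] powr_diff powr_minus power2_eq_square divide_simps)
  finally have exponent: "- 2 * real n * (c * real n powr (- t))\<^sup>2 / 25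
    = - (c\<^sup>2 * real n powr (1 - 2 * t) / 12.5)" .
  show ?thesis
  proof (intro conjI impI)
    assume "?E = 0"
    then have "?E + c * real n powr (- t) \<le> c * real n powr (- t)" by simp
    \<comment> \<open>The tail lemma carries both thresholds; the one for the opposite tail is set
      to the mean minus \<open>\<epsilon>\<close>, and in the second case below to the mean plus
      \<open>\<epsilon>\<close>.\<close>
    note bound = tail(1)[unfolded exponent, OF _ this order_refl]
    show "\<P>(\<omega> in M. (\<forall>k\<in>{1..K}. card (class_idx n (\<lambda>i. ys i \<omega>) (L k)) > 2) \<and>
        gini_cov_est \<kappa> n (\<lambda>i. xs i \<omega>) (\<lambda>i. ys i \<omega>) L K \<ge> c * real n powr (- t))
      \<le> exp (- (c\<^sup>2 * real n powr (1 - 2 * t) / 12.5))"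
      by (rule bound)
  next
    assume "?E \<ge> 2 * c * real n powr (- t)"
    then have "c * real n powr (- t) \<le> ?E - c * real n powr (- t)" by simp
    note bound = tail(2)[unfolded exponent, OF _ order_refl this]
    show "\<P>(\<omega> in M. (\<forall>k\<in>{1..K}. card (class_idx n (\<lambda>i. ys i \<omega>) (L k)) > 2) \<and>
        gini_cov_est \<kappa> n (\<lambda>i. xs i \<omega>) (\<lambda>i. ys i \<omega>) L K \<le> c * real n powr (- t))
      \<le> exp (- (c\<^sup>2 * real n powr (1 - 2 * t) / 12.5))"
      by (rule bound)
  qed
qed

end
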